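(* Let $k \in \{4,5\}$ and let $G$ be a finite simple $3$-connected $k$-$\gamma_c$-vertex critical claw-free graph. Then $G$ is Hamiltonian.
   Context: A connected dominating set of a graph $G$ is a set $D \subseteq V(G)$ such that every vertex outside $D$ has a neighbor in $D$ and the induced subgraph $G[D]$ is connected; $\gamma_c(G)$ is the minimum size of a connected dominating set. A graph $G$ is $k$-$\gamma_c$-vertex critical if $\gamma_c(G)=k$ and $\gamma_c(G-v)<k$ for every vertex $v$ of $G$. A graph is claw-free if it has no induced subgraph isomorphic to $K_{1,3}$. *)

theory Defs
  imports "Graph_Theory.Kuratowski" "HOL-Library.Extended_Nat"
begin

definition connected_dominating_set :: "('a,'b) pre_digraph \<Rightarrow> 'a set \<Rightarrow> bool" where
  "connected_dominating_set G D \<longleftrightarrow>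
     D \<subseteq> verts G \<and>
     (\<forall>v \<in> verts G - D. \<exists>u \<in> D. u \<rightarrow>\<^bsub>G\<^esub> v) \<and>
     Digraph_Component.connected (G \<restriction> D)"

(* The infimum is attained as a minimum whenever a connected dominating set exists; otherwise
   (disconnected or null G) the value is \<infinity>, so that it never counts as small. *)
definition gamma_c :: "('a,'b) pre_digraph \<Rightarrow> enat" where
  "gamma_c G = (INF D \<in> {D. connected_dominating_set G D}. enat (card D))"

definition gamma_c_vertex_critical :: "nat \<Rightarrow> ('a,'b) pre_digraph \<Rightarrow> bool" where
  "gamma_c_vertex_critical k G \<longleftrightarrow>
     gamma_c G = enat k \<and>
     (\<forall>v \<in> verts G. gamma_c (pre_digraph.del_vert G v) < enat k)"

definition claw_free :: "('a,'b) pre_digraph \<Rightarrow> bool" where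
  "claw_free G \<longleftrightarrow> \<not> (\<exists>H. induced_subgraph H G \<and> K\<^bsub>1,3\<^esub> H)"

definition k_connected :: "nat \<Rightarrow> ('a,'b) pre_digraph \<Rightarrow> bool" where
  "k_connected k G \<longleftrightarrow>
     k < card (verts G) \<and>
     (\<forall>S \<subseteq> verts G. card S < k \<longrightarrow> Digraph_Component.connected (G \<restriction> (verts G - S)))"

(* Graphs are symmetric digraphs, where an edge traversed back and forth is a cycle of length 2;
   the length bound excludes it. On a closed walk, the tails of the arcs are all the vertices. *)
definition hamiltonian :: "('a,'b) pre_digraph \<Rightarrow> bool" where
  "hamiltonian G \<longleftrightarrow>
     (\<exists>p. pre_digraph.cycle G p \<and> 3 \<le> length p \<and> tail G ` set p = verts G)"

end

theory Submission
  imports Defs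
begin

text \<open>
  Fix any vertex \<open>v\<close>; criticality gives a connected set \<open>D\<close> of at most four vertices dominating all
  vertices but \<open>v\<close>. Following Ryjacek's closure, completing the neighbourhood of a vertex \<open>x\<close> that is
  a hub of an induced diamond preserves claw-freeness and does not create Hamiltonicity, while
  3-connectedness and the role of \<open>D\<close> are trivially preserved; so we may assume that there is no
  induced diamond. Then the graph is the line graph of a graph \<open>F\<close> whose vertices (nodes) are the
  maximal cliques, and a closed trail of \<open>F\<close> meeting every edge of \<open>F\<close> yields a Hamiltonian cycle.

  The set \<open>R\<close> of nodes meeting \<open>D\<close> is connected, has at most five elements and covers every edge of
  \<open>F\<close> but \<open>v\<close>. Take a closed trail visiting as many nodes of \<open>R\<close> as possible, and then as many ends of
  \<open>v\<close> as possible. If an edge is missed, the unvisited component containing it is attached to the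
  trail by three edges at distinct nodes \<open>a1, a2, a3\<close>. Optimality forces each of the three parts of
  the trail between them to contain a private node of \<open>R\<close>. Counting leaves only the case
  \<open>R = {a1, r12, r23, r31, K}\<close> with \<open>K\<close> unvisited, and there an edge joining \<open>r23\<close> to another node of
  \<open>R\<close> produces a better trail.
\<close>

section \<open>Rearranging Hamiltonian paths\<close>

definition hamiltonian_cycle :: "('a \<Rightarrow> 'a \<Rightarrow> bool) \<Rightarrow> 'a set \<Rightarrow> 'a list \<Rightarrow> bool" where
  "hamiltonian_cycle E V c \<longleftrightarrow>
     distinct c \<and> set c = V \<and> 3 \<le> length c \<and> successively E c \<and> E (last c) (hd c)"

definition hamiltonian_path ::
  "('a \<Rightarrow> 'a \<Rightarrow> bool) \<Rightarrow> 'a set \<Rightarrow> 'a \<Rightarrow> 'a list \<Rightarrow> 'a \<Rightarrow> bool" where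
  "hamiltonian_path E V y P z \<longleftrightarrow>
     distinct P \<and> set P = V \<and> 3 \<le> length P \<and> successively E P \<and> hd P = y \<and> last P = z"

definition claw_free_rel :: "('a \<Rightarrow> 'a \<Rightarrow> bool) \<Rightarrow> bool" where
  "claw_free_rel E \<longleftrightarrow>
     (\<forall>x a b c. E x a \<longrightarrow> E x b \<longrightarrow> E x c \<longrightarrow> a \<noteq> b \<longrightarrow> a \<noteq> c \<longrightarrow> b \<noteq> c \<longrightarrow> E a b \<or> E a c \<or> E b c)"

definition diamond_free_rel :: "('a \<Rightarrow> 'a \<Rightarrow> bool) \<Rightarrow> bool" where
  "diamond_free_rel E \<longleftrightarrow>
     (\<forall>x w y z. E x w \<longrightarrow> E x y \<longrightarrow> E x z \<longrightarrow> E w y \<longrightarrow> E w z \<longrightarrow> y \<noteq> z \<longrightarrow> E y z)"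

lemma claw_free_relD:
  assumes "claw_free_rel E" "E x a" "E x b" "E x c" "a \<noteq> b" "a \<noteq> c" "b \<noteq> c"
  shows "E a b \<or> E a c \<or> E b c"
  using assms unfolding claw_free_rel_def by blast

lemma successively_rev_symp:
  assumes "symp E"
  shows "successively E (rev xs) \<longleftrightarrow> successively E xs"
proof -
  have "(\<lambda>x y. E y x) = E"
    using assms by (auto simp: symp_def fun_eq_iff)
  then show ?thesis
    by (metis successively_rev)
qed

lemma hamiltonian_path_rev:
  assumes "symp E" "hamiltonian_path E V y P z"
  shows "hamiltonian_path E V z (rev P) y"
  using assms
  by (simp add: hamiltonian_path_def successively_rev_symp hd_rev last_rev del: successively_rev)

text \<open>A Hamiltonian cycle can use the added edge only once. Cutting there and rotating leaves
  a list with ends \<open>y\<close> and \<open>z\<close> whose steps all lie in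
  \<open>E\<close>.\<close>

lemma hamiltonian_cycle_or_path:
  assumes "hamiltonian_cycle (\<lambda>a b. E a b \<or> {a, b} = {y, z}) V c" "symp E"
  shows "(\<exists>c. hamiltonian_cycle E V c) \<or> (\<exists>P. hamiltonian_path E V y P z)"
proof -
  let ?E = "\<lambda>a b. E a b \<or> {a, b} = {y, z}"
  have path: "\<exists>P. hamiltonian_path E V y P z"
    if P: "distinct P" "set P = V" "3 \<le> length P" "successively ?E P" "{last P, hd P} = {y, z}" for P
  proof -
    have "successively E P"
      unfolding successively_conv_nth
    proof (intro allI impI)
      fix i assume i: "Suc i < length P"
      have ne: "P \<noteq> []" using P(3) by auto
      have "?E (P ! i) (P ! Suc i)"
        using P(4) i by (auto simp: successively_conv_nth)
      \<comment> \<open>Neighbouring entries of a distinct list of length at least three cannot be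
        its two ends, so the added pair does not occur inside \<open>P\<close>.\<close>
      moreover have "{P ! i, P ! Suc i} \<noteq> {last P, hd P}"
      proof
        assume eq: "{P ! i, P ! Suc i} = {last P, hd P}"
        have l: "last P = P ! (length P - 1)" "hd P = P ! 0"
          using ne by (simp_all add: last_conv_nth hd_conv_nth)
        have "P ! i = P ! (length P - 1) \<or> P ! Suc i = P ! (length P - 1)"
          using eq l by (auto simp: doubleton_eq_iff)
        then have *: "Suc i = length P - 1"
          using i P(1) nth_eq_iff_index_eq[OF P(1)] by fastforce
        have "P ! i = P ! 0 \<or> P ! Suc i = P ! 0"
          using eq l by (auto simp: doubleton_eq_iff)
        then have "i = 0"
          using i ne nth_eq_iff_index_eq[OF P(1), of i 0] nth_eq_iff_index_eq[OF P(1), of "Suc i" 0]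
          by auto
        then show False using * P(3) by simp
      qed
      ultimately show "E (P ! i) (P ! Suc i)"
        using P(5) by auto
    qed
    then have "hamiltonian_path E V (hd P) P (last P)"
      using P by (simp add: hamiltonian_path_def)
    then show ?thesis
      using P(5) hamiltonian_path_rev[OF assms(2)] by (metis doubleton_eq_iff)
  qed
  have c: "distinct c" "set c = V" "3 \<le> length c" "successively ?E c" "?E (last c) (hd c)"
    using assms(1) by (auto simp: hamiltonian_cycle_def)
  show ?thesis
  proof (cases "successively E c")
    case True
    show ?thesis
    proof (cases "E (last c) (hd c)")
      case True
      with \<open>successively E c\<close> c show ?thesis by (auto simp: hamiltonian_cycle_def)
    next
      case False
      then have "{last c, hd c} = {y, z}" using c(5) by simp
      then have "\<exists>P. hamiltonian_path E V y P z"
        using c(1-4) by (intro path) auto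
      then show ?thesis by blast
    qed
  next
    case False
    then obtain i where i: "Suc i < length c" "\<not> E (c ! i) (c ! Suc i)"
      by (auto simp: successively_conv_nth)
    define c1 where "c1 = take (Suc i) c"
    define c2 where "c2 = drop (Suc i) c"
    have c12: "c = c1 @ c2" by (simp add: c1_def c2_def)
    have ne: "c1 \<noteq> []" "c2 \<noteq> []" using i by (auto simp: c1_def c2_def)
    have l: "last c1 = c ! i" "hd c2 = c ! Suc i"
      using i by (auto simp: c1_def c2_def take_Suc_conv_app_nth hd_drop_conv_nth)
    have "{c ! i, c ! Suc i} = {y, z}"
      using c(4) i by (auto simp: successively_conv_nth)
    then have "\<exists>P. hamiltonian_path E V y P z"
      using c ne l by (intro path[of "c2 @ c1"]) (auto simp: c12 successively_append_iff)
    then show ?thesis by blast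
  qed
qed

section \<open>Closing a Hamiltonian path by rearranging its segments\<close>

lemma hamiltonian_cycle_rearrange2:
  assumes "symp E" "hamiltonian_path E V y (A @ B) z" "A \<noteq> []" "B \<noteq> []"
    and "E (last A) z" "E (hd B) y"
  shows "hamiltonian_cycle E V (A @ rev B)"
  using assms unfolding hamiltonian_cycle_def hamiltonian_path_def
  by (simp add: successively_append_iff successively_rev_symp hd_rev last_rev del: successively_rev)

lemma hamiltonian_cycle_rearrange3:
  assumes "hamiltonian_path E V y (A @ B @ C) z" "A \<noteq> []" "B \<noteq> []" "C \<noteq> []"
    and "E (last A) (hd C)" "E z (hd B)" "E (last B) y"
  shows "hamiltonian_cycle E V (A @ C @ B)"
  using assms unfolding hamiltonian_cycle_def hamiltonian_path_def
  by (simp add: successively_append_iff) auto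

lemma hamiltonian_cycle_rearrange4a:
  assumes "symp E" "hamiltonian_path E V y (A @ B @ C @ D) z"
    and "A \<noteq> []" "B \<noteq> []" "C \<noteq> []" "D \<noteq> []"
    and "E (last A) (hd C)" "E (last C) (last B)" "E (hd B) z" "E (hd D) y"
  shows "hamiltonian_cycle E V (A @ C @ rev B @ rev D)"
  using assms unfolding hamiltonian_cycle_def hamiltonian_path_def
  by (simp add: successively_append_iff successively_rev_symp hd_rev last_rev del: successively_rev)
    auto

lemma hamiltonian_cycle_rearrange4b:
  assumes "symp E" "hamiltonian_path E V y (A @ B @ C @ D) z"
    and "A \<noteq> []" "B \<noteq> []" "C \<noteq> []" "D \<noteq> []"
    and "E (last A) (last B)" "E (hd B) (last C)" "E (hd C) z" "E (hd D) y"
  shows "hamiltonian_cycle E V (A @ rev B @ rev C @ rev D)"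
  using assms unfolding hamiltonian_cycle_def hamiltonian_path_def
  by (simp add: successively_append_iff successively_rev_symp hd_rev last_rev del: successively_rev)

text \<open>If adding the edge \<open>yz\<close> creates a Hamiltonian cycle, there is a Hamiltonian path from \<open>y\<close> to
  \<open>z\<close>. The absence of claws at a common neighbour \<open>x\<close> makes the successor of \<open>x\<close> a neighbour of \<open>z\<close>,
  and then almost every further common neighbour of \<open>x, y, z\<close> allows the path to be rearranged
  into a cycle.\<close>

locale hub_pair =
  fixes E :: "'a \<Rightarrow> 'a \<Rightarrow> bool" and V :: "'a set" and x y z :: 'a
  assumes symE: "symp E"
    and irreflE: "\<not> E a a"
    and nonham: "\<nexists>c. hamiltonian_cycle E V c"
    and hub: "E x y" "E x z"
    and nonadj: "\<not> E y z" "y \<noteq> z"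
    and no_claw: "\<lbrakk>E x u; u \<noteq> y; u \<noteq> z\<rbrakk> \<Longrightarrow> E u y \<or> E u z"
begin

lemma symD: "E a b \<Longrightarrow> E b a"
  using symE by (auto simp: symp_def)

lemma swap: "hub_pair E V x z y"
  using symE irreflE nonham hub nonadj no_claw symD by unfold_locales blast+

text \<open>Otherwise a cycle runs from \<open>y\<close> to \<open>c\<close>, jumps to
  \<open>z\<close> and goes backwards to the successor of \<open>c\<close>, which closes up at
  \<open>y\<close>.\<close>

lemma succ_not_adj:
  assumes P: "hamiltonian_path E V y (A @ [c] @ B) z" and c: "E c z" and B: "B \<noteq> []"
  shows "\<not> E (hd B) y"
  using hamiltonian_cycle_rearrange2[OF symE, of V y "A @ [c]" B z] P c B nonham by auto

text \<open>An edge from \<open>last M\<close> to \<open>y\<close> would close the path after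
  swapping \<open>M\<close> with the part from \<open>w\<close> on, by the edges from
  \<open>x\<close> to \<open>w\<close> and from \<open>z\<close> to \<open>hd M\<close>. An edge
  from \<open>last M\<close> to \<open>z\<close> would close it after reversing the part from
  \<open>w\<close> on, since \<open>w\<close> is adjacent to \<open>y\<close>.\<close>

lemma hub_later:
  assumes P: "hamiltonian_path E V y (A @ [x] @ M @ [w] @ B) z" and xw: "E x w"
    and w: "E w y" "E w z"
  shows "M \<noteq> [] \<and> B \<noteq> [] \<and> E (hd M) z \<and> \<not> E (last M) y \<and> \<not> E (last M) z \<and>
    last M \<notin> {y, z}"
proof -
  have wyz: "w \<noteq> y" "w \<noteq> z" using w irreflE by auto
  have xyz: "x \<noteq> y" "x \<noteq> z" using hub irreflE by auto
  have ends: "hd (A @ [x] @ M @ [w] @ B) = y" "last (A @ [x] @ M @ [w] @ B) = z"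
    and dist: "distinct (A @ [x] @ M @ [w] @ B)" and succ: "successively E (A @ [x] @ M @ [w] @ B)"
    using P by (auto simp: hamiltonian_path_def)
  have B: "B \<noteq> []"
    using ends wyz by auto
  then have zB: "z \<in> set B" using ends by auto
  have yA: "y \<in> set A" using ends xyz by (cases A) auto
  have "hd (M @ [w] @ B) \<noteq> w"
    using succ_not_adj[of A x "M @ [w] @ B"] P hub w by auto
  then have M: "M \<noteq> []" by auto
  then have hlM: "hd M \<in> set M" "last M \<in> set M" by auto
  have hM: "\<not> E (hd M) y"
    using succ_not_adj[of A x "M @ [w] @ B"] P hub M by auto
  have xM: "E x (hd M)" and Mw: "E (last M) w"
    using succ M by (simp_all add: successively_append_iff successively_Cons)
  have "hd M \<noteq> z" "hd M \<noteq> y"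
    using dist hlM zB yA by auto
  then have hMz: "E (hd M) z"
    using no_claw[OF xM] hM by auto
  have 1: "\<not> E (last M) y"
    using hamiltonian_cycle_rearrange3[of E V y "A @ [x]" M "[w] @ B" z]
      P M hMz xw symD[OF hMz] nonham by auto
  have 2: "\<not> E (last M) z"
    using hamiltonian_cycle_rearrange2[OF symE, of V y "A @ [x] @ M" "[w] @ B" z] P M w nonham by auto
  have "last M \<notin> {y, z}" using dist hlM zB yA by auto
  then show ?thesis using M B hMz 1 2 by blast
qed

lemma hub_later_succ:
  assumes "hamiltonian_path E V y P z" "P = A @ [x] @ C" "w \<in> set C" "E x w" "E w y" "E w z"
  shows "\<exists>u. E w u \<and> \<not> E u y \<and> \<not> E u z \<and> u \<notin> {y, z}"
proof -
  obtain M B where C: "C = M @ [w] @ B"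
    using assms(3) by (auto simp: in_set_conv_decomp)
  have "M \<noteq> []" "\<not> E (last M) y" "\<not> E (last M) z" "last M \<notin> {y, z}"
    using hub_later[of A M w B] assms C by auto
  moreover have "E (last M) w"
    using assms(1) \<open>M \<noteq> []\<close> unfolding assms(2) C hamiltonian_path_def
    by (simp add: successively_append_iff successively_Cons)
  ultimately show ?thesis using symD by blast
qed

text \<open>The vertex \<open>u\<close> is the neighbour of \<open>w\<close> on the path on the side
  of \<open>x\<close>. If \<open>w\<close> precedes \<open>x\<close>, the path is read backwards
  with \<open>y\<close> and \<open>z\<close> exchanged.\<close>

lemma second_hub:
  assumes P: "hamiltonian_path E V y P z" and V: "{x, w} \<subseteq> V" and w: "E x w" "E w y" "E w z"
  shows "\<exists>u. E w u \<and> \<not> E u y \<and> \<not> E u z \<and> u \<notin> {y, z}"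
proof -
  have "x \<in> V" "w \<in> V" "x \<noteq> w"
    using V w irreflE by auto
  have "x \<in> set P"
    using P \<open>x \<in> V\<close> by (simp add: hamiltonian_path_def)
  then obtain A C where AC: "P = A @ [x] @ C"
    by (auto simp: in_set_conv_decomp)
  interpret sw: hub_pair E V x z y by (rule swap)
  show ?thesis
  proof (cases "w \<in> set C")
    case True
    then show ?thesis using hub_later_succ[OF P AC] w by auto
  next
    case False
    then have "w \<in> set (rev A)"
      using P AC \<open>w \<in> V\<close> \<open>x \<noteq> w\<close> by (auto simp: hamiltonian_path_def)
    then show ?thesis
      using sw.hub_later_succ[OF hamiltonian_path_rev[OF symE P], of "rev C" "rev A" w] w AC by auto
  qed
qed

text \<open>Here \<open>u\<close> and \<open>u'\<close> are the predecessors of \<open>w\<close> and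
  \<open>w'\<close>. An edge between them would give the cycle
  \<open>y..x, w..u', u..hd M, z..w'\<close>.\<close>

lemma two_hubs_later:
  assumes P: "hamiltonian_path E V y (A @ [x] @ M @ [w] @ N @ [w'] @ B) z"
    and w: "E x w" "E w y" "E w z" and w': "E x w'" "E w' y" "E w' z"
  shows "\<exists>u u'. E w u \<and> E w' u' \<and> u \<noteq> u' \<and> \<not> E u u' \<and>
    \<not> E u y \<and> \<not> E u z \<and> u \<notin> {y, z} \<and> \<not> E u' y \<and> \<not> E u' z \<and> u' \<notin> {y, z}"
proof -
  have 1: "M \<noteq> []" "E (hd M) z" "\<not> E (last M) y" "\<not> E (last M) z" "last M \<notin> {y, z}"
    using hub_later[of A M w "N @ [w'] @ B"] P w by auto
  have 2: "B \<noteq> []" "\<not> E (last (M @ [w] @ N)) y" "\<not> E (last (M @ [w] @ N)) z" "last (M @ [w] @ N) \<notin> {y, z}"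
    using hub_later[of A "M @ [w] @ N" w' B] P w' by auto
  have N: "N \<noteq> []" using 2 w by auto
  have dist: "distinct (A @ [x] @ M @ [w] @ N @ [w'] @ B)"
    and succ: "successively E (A @ [x] @ M @ [w] @ N @ [w'] @ B)"
    using P by (auto simp: hamiltonian_path_def)
  have "last M \<in> set M" "last N \<in> set N" using 1 N by auto
  then have ne: "last M \<noteq> last N" using dist by auto
  have adj: "E (last M) w" "E (last N) w'"
    using succ 1 N by (simp_all add: successively_append_iff successively_Cons)
  have "\<not> E (last N) (last M)"
    using hamiltonian_cycle_rearrange4a[OF symE, of V y "A @ [x]" M "[w] @ N" "[w'] @ B" z]
      P 1 2 N w w' nonham by auto
  then show ?thesis using 1 2 N ne adj symD by auto
qed

text \<open>Here \<open>u\<close> is the successor of \<open>w\<close> and \<open>u'\<close> the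
  predecessor of \<open>w'\<close>. An edge between them would give the cycle
  \<open>y..w, x..u, u'..hd N, z..w'\<close>.\<close>

lemma two_hubs_around:
  assumes P: "hamiltonian_path E V y (A @ [w] @ M @ [x] @ N @ [w'] @ B) z"
    and w: "E x w" "E w y" "E w z" and w': "E x w'" "E w' y" "E w' z"
  shows "\<exists>u u'. E w u \<and> E w' u' \<and> u \<noteq> u' \<and> \<not> E u u' \<and>
    \<not> E u y \<and> \<not> E u z \<and> u \<notin> {y, z} \<and> \<not> E u' y \<and> \<not> E u' z \<and> u' \<notin> {y, z}"
proof -
  interpret sw: hub_pair E V x z y by (rule swap)
  have 1: "M \<noteq> []" "\<not> E (hd M) y" "\<not> E (hd M) z" "hd M \<notin> {y, z}"
    using sw.hub_later[of "rev (N @ [w'] @ B)" "rev M" w "rev A"] w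
      hamiltonian_path_rev[OF symE P] by (auto simp: last_rev)
  have 2: "N \<noteq> []" "B \<noteq> []" "E (hd N) z" "\<not> E (last N) y" "\<not> E (last N) z" "last N \<notin> {y, z}"
    using hub_later[of "A @ [w] @ M" N w' B] P w' by auto
  have dist: "distinct (A @ [w] @ M @ [x] @ N @ [w'] @ B)"
    and succ: "successively E (A @ [w] @ M @ [x] @ N @ [w'] @ B)"
    using P by (auto simp: hamiltonian_path_def)
  have "hd M \<in> set M" "last N \<in> set N" using 1 2 by auto
  then have ne: "hd M \<noteq> last N" using dist by auto
  have adj: "E w (hd M)" "E (last N) w'"
    using succ 1 2 by (simp_all add: successively_append_iff successively_Cons)
  have "\<not> E (hd M) (last N)"
    using hamiltonian_cycle_rearrange4b[OF symE, of V y "A @ [w]" "M @ [x]" N "[w'] @ B" z]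
      P 1 2 w w' nonham symD by auto
  then show ?thesis using 1 2 ne adj symD by auto
qed

lemma two_hubs_after:
  assumes P: "hamiltonian_path E V y (A @ [x] @ C) z" and C: "w \<in> set C" "w' \<in> set C" "w \<noteq> w'"
    and w: "E x w" "E w y" "E w z" and w': "E x w'" "E w' y" "E w' z"
  shows "\<exists>u u'. E w u \<and> E w' u' \<and> u \<noteq> u' \<and> \<not> E u u' \<and>
    \<not> E u y \<and> \<not> E u z \<and> u \<notin> {y, z} \<and> \<not> E u' y \<and> \<not> E u' z \<and> u' \<notin> {y, z}"
proof -
  obtain M B where MB: "C = M @ [w] @ B"
    using C(1) by (auto simp: in_set_conv_decomp)
  show ?thesis
  proof (cases "w' \<in> set B")
    case True
    then obtain N B' where "B = N @ [w'] @ B'" by (auto simp: in_set_conv_decomp)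
    then show ?thesis using two_hubs_later[of A M w N w' B'] P MB w w' by auto
  next
    case False
    then have "w' \<in> set M" using C MB by auto
    then obtain M' N where "M = M' @ [w'] @ N" by (auto simp: in_set_conv_decomp)
    then have "\<exists>u u'. E w' u \<and> E w u' \<and> u \<noteq> u' \<and> \<not> E u u' \<and>
      \<not> E u y \<and> \<not> E u z \<and> u \<notin> {y, z} \<and> \<not> E u' y \<and> \<not> E u' z \<and> u' \<notin> {y, z}"
      using two_hubs_later[of A M' w' N w B] P MB w w' by auto
    then show ?thesis using symD by blast
  qed
qed

lemma two_hubs_before_after:
  assumes P: "hamiltonian_path E V y (A @ [x] @ C) z" and C: "w \<in> set A" "w' \<in> set C"
    and w: "E x w" "E w y" "E w z" and w': "E x w'" "E w' y" "E w' z"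
  shows "\<exists>u u'. E w u \<and> E w' u' \<and> u \<noteq> u' \<and> \<not> E u u' \<and>
    \<not> E u y \<and> \<not> E u z \<and> u \<notin> {y, z} \<and> \<not> E u' y \<and> \<not> E u' z \<and> u' \<notin> {y, z}"
proof -
  obtain A1 A2 C1 C2 where "A = A1 @ [w] @ A2" "C = C1 @ [w'] @ C2"
    using C by (auto simp: in_set_conv_decomp)
  then show ?thesis using two_hubs_around[of A1 w A2 C1 w' C2] P w w' by auto
qed

lemma two_more_hubs:
  assumes P: "hamiltonian_path E V y P z" and ne: "w \<noteq> w'" and V: "{x, w, w'} \<subseteq> V"
    and w: "E x w" "E w y" "E w z" and w': "E x w'" "E w' y" "E w' z"
  shows "\<exists>u u'. E w u \<and> E w' u' \<and> u \<noteq> u' \<and> \<not> E u u' \<and>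
    \<not> E u y \<and> \<not> E u z \<and> u \<notin> {y, z} \<and> \<not> E u' y \<and> \<not> E u' z \<and> u' \<notin> {y, z}"
proof -
  have "x \<noteq> w" "x \<noteq> w'" using w w' irreflE by auto
  have "x \<in> set P"
    using P V by (simp add: hamiltonian_path_def)
  then obtain A C where AC: "P = A @ [x] @ C"
    by (auto simp: in_set_conv_decomp)
  interpret sw: hub_pair E V x z y by (rule swap)
  have revP: "hamiltonian_path E V z (rev C @ [x] @ rev A) y"
    using hamiltonian_path_rev[OF symE P] AC by simp
  have "w \<in> set A \<or> w \<in> set C" "w' \<in> set A \<or> w' \<in> set C"
    using P V AC \<open>x \<noteq> w\<close> \<open>x \<noteq> w'\<close> by (auto simp: hamiltonian_path_def)
  then consider "w \<in> set C" "w' \<in> set C" | "w \<in> set A" "w' \<in> set A"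
    | "w \<in> set A" "w' \<in> set C" | "w' \<in> set A" "w \<in> set C" by blast
  then show ?thesis
  proof cases
    case 1
    then show ?thesis using two_hubs_after[of A C w w'] P AC ne w w' by simp
  next
    case 2
    then show ?thesis using sw.two_hubs_after[OF revP, of w w'] ne w w' by auto
  next
    case 3
    then show ?thesis using two_hubs_before_after[of A C w w'] P AC w w' by simp
  next
    case 4
    then obtain u u' where "E w' u" "E w u'" "u \<noteq> u'" "\<not> E u u'"
      "\<not> E u y" "\<not> E u z" "u \<notin> {y, z}" "\<not> E u' y" "\<not> E u' z" "u' \<notin> {y, z}"
      using two_hubs_before_after[of A C w' w] P AC w w' by auto
    then show ?thesis using symD by blast
  qed
qed

end

section \<open>Local completion\<close>

definition local_completion :: "('a \<Rightarrow> 'a \<Rightarrow> bool) \<Rightarrow> 'a \<Rightarrow> 'a \<Rightarrow> 'a \<Rightarrow> bool" where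
  "local_completion E x a b \<longleftrightarrow> E a b \<or> (E x a \<and> E x b \<and> a \<noteq> b)"

text \<open>At most one leaf of a new claw lies in the clique formed by \<open>x\<close> and its
  neighbours. If the centre is a neighbour of \<open>x\<close>, two other leaves and
  \<open>x\<close> form a claw of \<open>E\<close>; if not, no edge at the centre is new.\<close>

lemma claw_free_local_completion:
  assumes sym: "symp E" and irr: "irreflp E" and cf: "claw_free_rel E"
  shows "claw_free_rel (local_completion E x)"
  unfolding claw_free_rel_def
proof (intro allI impI, rule ccontr)
  fix c p q r
  let ?E = "local_completion E x"
  assume adj: "?E c p" "?E c q" "?E c r" and ne: "p \<noteq> q" "p \<noteq> r" "q \<noteq> r"
    and "\<not> (?E p q \<or> ?E p r \<or> ?E q r)"
  then have na: "\<not> ?E p q" "\<not> ?E p r" "\<not> ?E q r" by auto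
  have symD: "E a b \<Longrightarrow> E b a" for a b using sym by (auto simp: symp_def)
  have nE: "\<not> E p q" "\<not> E p r" "\<not> E q r"
    using na by (auto simp: local_completion_def)
  show False
  proof (cases "E x c")
    case False
    then have "E c p" "E c q" "E c r"
      using adj by (auto simp: local_completion_def)
    then show False using claw_free_relD[OF cf] ne nE by blast
  next
    case True
    define I where "I = {a. E x a \<or> a = x}"
    have one: "a = b" if "a \<in> I" "b \<in> I" "\<not> ?E a b" for a b
      using that symD by (auto simp: I_def local_completion_def)
    have two: False
      if "a \<noteq> b" "\<not> E a b" "?E c a" "?E c b" "a \<notin> I" "b \<notin> I" for a b
      using claw_free_relD[OF cf, of c x a b] that symD[OF True]
      by (auto simp: I_def local_completion_def)
    show False
      using one[of p q] one[of p r] one[of q r] two[of p q] two[of p r] two[of q r] ne na nE adj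
      by blast
  qed
qed

lemma add_edge_symp:
  "symp E \<Longrightarrow> symp (\<lambda>a b. E a b \<or> {a, b} = {y, z})"
  by (auto simp: symp_def insert_commute)

text \<open>The new edges are handled one at a time: \<open>F\<close> is a largest graph between
  \<open>E\<close> and the completion without a Hamiltonian cycle. Neighbours \<open>y, z\<close> of
  \<open>x\<close> not joined in \<open>F\<close> would be the ends of a Hamiltonian path of
  \<open>F\<close>. Excluding all such pairs makes \<open>F\<close> the whole completion.\<close>

theorem hamiltonian_local_completion:
  assumes fin: "finite V" and sym: "symp E" and irr: "irreflp E" and V: "\<And>a b. E a b \<Longrightarrow> a \<in> V"
    and cf: "claw_free_rel E"
    and diamond: "E x w\<^sub>0" "E x y\<^sub>0" "E x z\<^sub>0" "E w\<^sub>0 y\<^sub>0" "E w\<^sub>0 z\<^sub>0" "y\<^sub>0 \<noteq> z\<^sub>0" "\<not> E y\<^sub>0 z\<^sub>0"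
    and ham: "hamiltonian_cycle (local_completion E x) V c"
  shows "\<exists>c. hamiltonian_cycle E V c"
proof (rule ccontr)
  assume non: "\<nexists>c. hamiltonian_cycle E V c"
  let ?E' = "local_completion E x"
  have E_sym: "E a b \<Longrightarrow> E b a" for a b using sym by (auto simp: symp_def)
  have irrE: "\<not> E a a" for a using irr by (auto simp: irreflp_def)
  define between where "between F \<longleftrightarrow> E \<le> F \<and> F \<le> ?E' \<and> symp F \<and> (\<nexists>c. hamiltonian_cycle F V c)" for F
  define size where "size F = card {(a, b). F a b}" for F :: "'a \<Rightarrow> 'a \<Rightarrow> bool"
  have E'V: "{(a, b). ?E' a b} \<subseteq> V \<times> V"
    using V E_sym by (auto simp: local_completion_def)
  have sub: "{(a, b). F a b} \<subseteq> {(a, b). ?E' a b}" if "between F" for F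
    using that by (auto simp: between_def)
  have finF: "finite {(a, b). F a b}" if "between F" for F
    using sub[OF that] E'V fin by (meson finite_SigmaI finite_subset)
  have "between E"
    using sym non by (auto simp: between_def local_completion_def)
  moreover have "size F \<le> card (V \<times> V)" if "between F" for F
    unfolding size_def using sub[OF that] E'V fin by (intro card_mono) auto
  ultimately have "\<exists>F. between F \<and> (\<forall>F'. between F' \<longrightarrow> size F' \<le> size F)"
    by (intro ex_has_greatest_nat[of between E size "Suc (card (V \<times> V))"]) (auto simp: less_Suc_eq_le)
  then obtain F where F: "between F" and F_max: "\<And>F'. between F' \<Longrightarrow> size F' \<le> size F"
    by auto
  have EF: "E a b \<Longrightarrow> F a b" and FE': "F a b \<Longrightarrow> ?E' a b" for a b
    using F by (auto simp: between_def)
  have symF: "symp F" and nonF: "\<nexists>c. hamiltonian_cycle F V c"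
    using F by (auto simp: between_def)
  have F_sym: "F a b \<Longrightarrow> F b a" for a b using symF by (auto simp: symp_def)
  have irrF: "\<not> F a a" for a using FE'[of a a] irrE by (auto simp: local_completion_def)
  have FE: "F a b \<Longrightarrow> \<not> E x b \<Longrightarrow> E a b" for a b
    using FE'[of a b] by (auto simp: local_completion_def)
  have xF: "F x a \<longleftrightarrow> E x a" for a
    using EF FE'[of x a] irrE by (auto simp: local_completion_def)
  have nbhd: "E u y \<or> E u z" if "E x y" "E x z" "E x u" "u \<noteq> y" "u \<noteq> z" "\<not> E y z" "y \<noteq> z" for u y z
    using claw_free_relD[OF cf, of x u y z] that by auto
  have path: "\<exists>P. hamiltonian_path F V y P z" and hub: "hub_pair F V x y z"
    if yz: "E x y" "E x z" "y \<noteq> z" "\<not> F y z" for y z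
  proof -
    define F' where "F' = (\<lambda>a b. F a b \<or> {a, b} = {y, z})"
    have "\<not> between F'"
    proof
      assume b: "between F'"
      have "{(a, b). F a b} \<subset> {(a, b). F' a b}"
        using yz by (auto simp: F'_def)
      then have "size F < size F'"
        unfolding size_def using finF[OF b] by (rule psubset_card_mono[rotated])
      then show False using F_max[OF b] by simp
    qed
    moreover have "E \<le> F'" using EF by (auto simp: F'_def)
    moreover have "F' \<le> ?E'" using FE' yz by (auto simp: F'_def doubleton_eq_iff local_completion_def)
    moreover have "symp F'" unfolding F'_def by (rule add_edge_symp[OF symF])
    ultimately obtain c where "hamiltonian_cycle F' V c"
      by (auto simp: between_def)
    then show "\<exists>P. hamiltonian_path F V y P z"
      using hamiltonian_cycle_or_path[OF _ symF] nonF unfolding F'_def by blast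
    show "hub_pair F V x y z"
    proof
      show "F u y \<or> F u z" if "F x u" "u \<noteq> y" "u \<noteq> z" for u
        using nbhd[of y z u] that yz xF EF by blast
    qed (use symF irrF nonF yz EF in auto)
  qed
  \<comment> \<open>Pairs with a common neighbour inside the neighbourhood of \<open>x\<close> come first; they provide the two
    additional hubs for the pairs at distance three.\<close>
  have common: "F y z"
    if h: "E x y" "E x z" "y \<noteq> z" "E x w" "E w y" "E w z" for y z w
  proof (rule ccontr)
    assume n: "\<not> F y z"
    obtain P where P: "hamiltonian_path F V y P z" using path[of y z] h n by blast
    interpret hub_pair F V x y z using hub[of y z] h n by blast
    have "{x, w} \<subseteq> V" using h V by blast
    then obtain u where u: "F w u" "\<not> F u y" "\<not> F u z" "u \<notin> {y, z}"
      using second_hub[OF P, of w] h EF by blast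
    have "u \<noteq> y" "u \<noteq> z" using u by auto
    \<comment> \<open>The vertices \<open>u, y, z\<close> are pairwise nonadjacent in
      \<open>E\<close>. They form a claw at \<open>x\<close> if \<open>u\<close> is a neighbour of
      \<open>x\<close>, and otherwise at \<open>w\<close>, because the edge \<open>wu\<close> of
      \<open>F\<close> is then an edge of \<open>E\<close>.\<close>
    show False
    proof (cases "E x u")
      case True
      then show False using nbhd[of y z u] h u n \<open>u \<noteq> y\<close> \<open>u \<noteq> z\<close> EF by blast
    next
      case False
      then have "E w u" using FE u by blast
      then show False
        using claw_free_relD[OF cf, of w u y z] h u n \<open>u \<noteq> y\<close> \<open>u \<noteq> z\<close> EF by blast
    qed
  qed
  have all: "F y z" if yz: "E x y" "E x z" "y \<noteq> z" for y z
  proof (rule ccontr)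
    assume n: "\<not> F y z"
    then have nE: "\<not> E y z" using EF by blast
    have no_common: "\<not> (E u y \<and> E u z)" if "E x u" for u
      using common[of y z u] yz that n by blast
    \<comment> \<open>\<open>A\<close> and \<open>B\<close> are disjoint cliques covering the
      neighbourhood of \<open>x\<close>; the assumed diamond provides an edge \<open>ww'\<close>
      between them.\<close>
    define A where "A = {u. E x u \<and> (u = y \<or> E u y)}"
    define B where "B = {u. E x u \<and> (u = z \<or> E u z)}"
    have AB: "u \<in> A \<or> u \<in> B" if "E x u" for u
      using nbhd[of y z u] that yz nE by (auto simp: A_def B_def)
    have A: "E p q" if "p \<in> A" "q \<in> A" "p \<noteq> q" for p q
      using claw_free_relD[OF cf, of x p q z] that yz nE no_common[of p] no_common[of q] E_sym
      by (auto simp: A_def)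
    have B: "E p q" if "p \<in> B" "q \<in> B" "p \<noteq> q" for p q
      using claw_free_relD[OF cf, of x p q y] that yz nE no_common[of p] no_common[of q] E_sym
      by (auto simp: B_def)
    obtain w w' where ww: "w \<in> A" "w' \<in> B" "E w w'"
    proof -
      have "(y\<^sub>0 \<in> A \<and> z\<^sub>0 \<in> B) \<or> (y\<^sub>0 \<in> B \<and> z\<^sub>0 \<in> A)"
        using AB[of y\<^sub>0] AB[of z\<^sub>0] diamond A B by blast
      moreover have "w\<^sub>0 \<in> A \<or> w\<^sub>0 \<in> B" using AB diamond by blast
      ultimately show thesis using that diamond E_sym by blast
    qed
    have xw: "E x w" "E x w'" using ww by (auto simp: A_def B_def)
    have w_y: "w \<noteq> y" using ww no_common[of w'] nE by (auto simp: A_def B_def dest: E_sym)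
    have w'_z: "w' \<noteq> z" using ww no_common[of w] nE by (auto simp: A_def B_def dest: E_sym)
    have e: "E w y" "E w' z" using ww w_y w'_z by (auto simp: A_def B_def)
    have ne: "\<not> E w z" "\<not> E w' y" using no_common xw e by blast+
    have wz: "w \<noteq> z" "w' \<noteq> y" "w \<noteq> w'" using e nE ne irrE ww E_sym by auto
    \<comment> \<open>Each of \<open>w, w'\<close> is a common neighbour for the other and its far
      vertex, so \<open>common\<close> applies. Both become hubs in \<open>F\<close>, although
      neither is one in \<open>E\<close>.\<close>
    have f: "F w z" "F w' y"
      using common[of w z w'] common[of w' y w] xw yz wz e ww E_sym by blast+
    obtain P where P: "hamiltonian_path F V y P z" using path[of y z] yz n by blast
    interpret hub_pair F V x y z using hub[of y z] yz n by blast
    have "{x, w, w'} \<subseteq> V" using xw V E_sym by blast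
    then obtain u u' where u: "F w u" "F w' u'" "u \<noteq> u'" "\<not> F u u'"
      "\<not> F u y" "\<not> F u z" "u \<notin> {y, z}" "\<not> F u' y" "\<not> F u' z" "u' \<notin> {y, z}"
      using two_more_hubs[OF P, of w w'] wz xw e f EF by blast
    have uyz: "u \<noteq> y" "u \<noteq> z" "u' \<noteq> y" "u' \<noteq> z" using u by auto
    have out: "\<not> E x u" "\<not> E x u'"
      using nbhd[of y z u] nbhd[of y z u'] yz nE uyz u EF by blast+
    have Eu: "E w u" "E w' u'" using FE out u by blast+
    have "u \<noteq> w'" "x \<noteq> u" "x \<noteq> u'" using u f yz EF by auto
    \<comment> \<open>Claw-freeness at \<open>w\<close> forces the edge \<open>uw'\<close>; then
      \<open>x, u, u'\<close> form a claw at \<open>w'\<close>.\<close>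
    have "E u y \<or> E u w' \<or> E y w'"
      using ww e uyz \<open>u \<noteq> w'\<close> wz by (intro claw_free_relD[OF cf Eu(1)]) auto
    then have "E u w'" using u(5) EF ne(2) E_sym by blast
    then have "E x u \<or> E x u' \<or> E u u'"
      using Eu(2) xw(2) \<open>x \<noteq> u\<close> \<open>x \<noteq> u'\<close> u(3)
      by (intro claw_free_relD[OF cf, of w']) (auto intro: E_sym)
    then show False using out u(4) EF by blast
  qed
  have "?E' = F"
  proof (intro ext iffI)
    show "F a b" if "?E' a b" for a b
      using that all EF by (auto simp: local_completion_def)
  qed (rule FE')
  then show False using ham nonF by auto
qed

section \<open>Trails in the preimage of a line graph\<close>

text \<open>Connectivity in terms of cuts: this form is inherited when edges are added, and it lets
  a connected set be grown one vertex at a time. The empty set satisfies it.\<close>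

definition cut_connected :: "('a \<Rightarrow> 'a \<Rightarrow> bool) \<Rightarrow> 'a set \<Rightarrow> bool" where
  "cut_connected E X \<longleftrightarrow> (\<forall>A. A \<subseteq> X \<longrightarrow> A \<noteq> {} \<longrightarrow> A \<noteq> X \<longrightarrow> (\<exists>a\<in>A. \<exists>b\<in>X - A. E a b))"

text \<open>The elements of \<open>V\<close> play the role of the edges of a simple graph whose vertices are the sets in
  \<open>\<N>\<close>: a node is identified with the set of edges at it. An edge may lie in a single node.\<close>

locale line_structure =
  fixes V :: "'a set" and \<N> :: "'a set set"
  assumes finite_V: "finite V"
    and node_subset: "N \<in> \<N> \<Longrightarrow> N \<subseteq> V"
    and linear: "\<lbrakk>A \<in> \<N>; B \<in> \<N>; A \<noteq> B; e \<in> A; e \<in> B; f \<in> A; f \<in> B\<rbrakk> \<Longrightarrow> e = f"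
    and two_nodes: "\<lbrakk>A \<in> \<N>; B \<in> \<N>; C \<in> \<N>; e \<in> A; e \<in> B; e \<in> C\<rbrakk> \<Longrightarrow> A = B \<or> A = C \<or> B = C"
begin

definition adj :: "'a \<Rightarrow> 'a \<Rightarrow> bool" where
  "adj e f \<longleftrightarrow> e \<noteq> f \<and> (\<exists>N\<in>\<N>. e \<in> N \<and> f \<in> N)"

lemma finite_nodes: "finite \<N>"
proof (rule finite_subset)
  show "\<N> \<subseteq> Pow V" using node_subset by auto
qed (use finite_V in simp)

text \<open>The last argument is the set of visited nodes; edges may repeat.\<close>

inductive trail :: "'a set \<Rightarrow> 'a list \<Rightarrow> 'a set \<Rightarrow> 'a set set \<Rightarrow> bool" where
  Nil: "A \<in> \<N> \<Longrightarrow> trail A [] A {A}"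
| Cons: "\<lbrakk>A \<in> \<N>; A \<noteq> B; e \<in> A; e \<in> B; trail B p C W\<rbrakk> \<Longrightarrow> trail A (e # p) C (insert A W)"

lemma trail_nodes: "trail A p B W \<Longrightarrow> W \<subseteq> \<N> \<and> A \<in> W \<and> B \<in> W"
  by (induction rule: trail.induct) auto

lemma trail_append: "trail A p B W \<Longrightarrow> trail B q C W' \<Longrightarrow> trail A (p @ q) C (W \<union> W')"
proof (induction rule: trail.induct)
  case (Nil A)
  then show ?case using trail_nodes[of A q C W'] by (simp add: insert_absorb)
next
  case (Cons A B e p D W)
  then show ?case using trail.Cons[of A B e "p @ q" C "W \<union> W'"] by simp
qed

lemma trail_single: "\<lbrakk>A \<in> \<N>; B \<in> \<N>; A \<noteq> B; e \<in> A; e \<in> B\<rbrakk> \<Longrightarrow> trail A [e] B {A, B}"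
  using trail.Cons[OF _ _ _ _ trail.Nil] by blast

lemma trail_rev: "trail A p B W \<Longrightarrow> trail B (rev p) A W"
proof (induction rule: trail.induct)
  case (Nil A)
  then show ?case using trail.Nil by simp
next
  case (Cons A B e p C W)
  have "B \<in> W" "B \<in> \<N>" using trail_nodes[OF Cons(5)] by auto
  then have "trail C (rev p @ [e]) A (W \<union> {B, A})"
    using Cons by (intro trail_append[OF Cons.IH] trail_single) auto
  moreover have "W \<union> {B, A} = insert A W" using \<open>B \<in> W\<close> by auto
  ultimately show ?case by simp
qed

lemma trail_split:
  "trail A p B W \<Longrightarrow> X \<in> W \<Longrightarrow>
    \<exists>p1 p2 W1 W2. p = p1 @ p2 \<and> W = W1 \<union> W2 \<and> trail A p1 X W1 \<and> trail X p2 B W2"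
proof (induction rule: trail.induct)
  case (Nil A)
  then show ?case using trail.Nil[of A] by (intro exI[of _ "[]"] exI[of _ "{A}"]) auto
next
  case (Cons A B e p C W)
  have all: "trail A (e # p) C (insert A W)" using Cons trail.Cons by blast
  show ?case
  proof (cases "X = A")
    case True
    then show ?thesis
      using all trail.Nil[of A] Cons(1)
      by (intro exI[of _ "[]"] exI[of _ "e # p"] exI[of _ "{A}"] exI[of _ "insert A W"]) auto
  next
    case False
    then obtain p1 p2 W1 W2 where s: "p = p1 @ p2" "W = W1 \<union> W2" "trail B p1 X W1" "trail X p2 C W2"
      using Cons by blast
    then show ?thesis
      using trail.Cons[OF Cons(1-4) s(3)]
      by (intro exI[of _ "e # p1"] exI[of _ p2] exI[of _ "insert A W1"] exI[of _ W2]) auto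
  qed
qed

text \<open>An edge has at most two ends, and a trail visits both ends of each of its edges.\<close>

lemma trail_edge_nodes:
  "trail A p B W \<Longrightarrow> e \<in> set p \<Longrightarrow> N \<in> \<N> \<Longrightarrow> e \<in> N \<Longrightarrow> N \<in> W"
proof (induction rule: trail.induct)
  case (Cons A B f p C W)
  have "B \<in> W" "B \<in> \<N>" using trail_nodes[OF Cons(5)] by auto
  then show ?case
    using Cons two_nodes[of A B N e] by auto
qed simp

lemma trail_edge_in_node: "trail A p B W \<Longrightarrow> e \<in> set p \<Longrightarrow> \<exists>N\<in>W. e \<in> N"
  by (induction rule: trail.induct) auto

text \<open>The vertices that are not edges of the trail are inserted, as a block, when the trail first
  enters a node containing them.\<close>

lemma trail_to_path:
  "\<lbrakk>trail A p B W; distinct p; Y \<subseteq> V; Y \<inter> set p = {}; \<forall>y\<in>Y. \<exists>N\<in>W. y \<in> N\<rbrakk> \<Longrightarrow>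
    \<exists>c. distinct c \<and> set c = set p \<union> Y \<and> successively adj c \<and> (c \<noteq> [] \<longrightarrow> hd c \<in> A \<and> last c \<in> B)"
proof (induction arbitrary: Y rule: trail.induct)
  case (Nil A)
  have "finite Y" using Nil(3) finite_V by (rule finite_subset)
  then obtain c where c: "distinct c" "set c = Y"
    using finite_distinct_list by blast
  have sub: "set c \<subseteq> A" using c Nil by auto
  then have "successively adj c"
    using c(1) Nil(1)
  proof (induction c)
    case (Cons a c)
    then show ?case by (cases c) (auto simp: adj_def)
  qed simp
  moreover have "hd c \<in> A" "last c \<in> A" if "c \<noteq> []"
    using sub hd_in_set[OF that] last_in_set[OF that] by auto
  ultimately show ?case using c by (intro exI[of _ c]) simp
next
  case (Cons A B e p C W)
  have "finite (Y \<inter> A)" using Cons.prems(2) finite_V by (blast intro: finite_subset)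
  then obtain l where l: "distinct l" "set l = Y \<inter> A"
    using finite_distinct_list by blast
  obtain c where c: "distinct c" "set c = set p \<union> (Y - A)" "successively adj c"
    "c \<noteq> [] \<longrightarrow> hd c \<in> B \<and> last c \<in> C"
    using Cons.IH[of "Y - A"] Cons.prems by auto
  have B: "B \<in> \<N>" using trail_nodes[OF Cons(5)] by auto
  have le: "successively adj (l @ [e])"
  proof -
    have "set l \<subseteq> A" "e \<in> A" "e \<notin> set l" using l Cons by auto
    then show ?thesis
      using l(1) Cons(1)
    proof (induction l)
      case (Cons a l)
      then show ?case by (cases l) (auto simp: adj_def)
    qed simp
  qed
  have ec: "adj e (hd c)" if "c \<noteq> []"
  proof -
    have "e \<notin> set c" using Cons.prems(1,3) c(2) by auto
    then show ?thesis using that c(4) Cons(4) B hd_in_set[OF that] by (auto simp: adj_def)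
  qed
  \<comment> \<open>An empty \<open>c\<close> means that no edge of the trail remains; then
    \<open>e\<close> is the last entry and must lie in \<open>C\<close>.\<close>
  have CB: "C = B" if "c = []"
    using Cons(5) that c(2) by (cases rule: trail.cases) auto
  have "distinct (l @ [e] @ c)" using l c(1,2) Cons.prems(1,3) by auto
  moreover have "set (l @ [e] @ c) = set (e # p) \<union> Y" using l(2) c(2) by auto
  moreover have "successively adj (l @ [e] @ c)"
    using le ec c(3) successively_append_iff[of adj "l @ [e]" c] by auto
  moreover have "hd (l @ [e] @ c) \<in> A"
    using l(2) Cons(3) by (cases l) auto
  moreover have "last (l @ [e] @ c) \<in> C"
    using c(4) CB Cons(4) by auto
  ultimately show ?case by (intro exI[of _ "l @ [e] @ c"]) blast
qed

text \<open>One direction of the Harary--Nash-Williams theorem: the path given by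
  \<open>trail_to_path\<close> has both ends in the node \<open>A\<close>, so it closes up.\<close>

lemma closed_trail_hamiltonian:
  assumes "trail A p A W" "distinct p" "set p \<subseteq> V" "\<And>e. e \<in> V \<Longrightarrow> \<exists>N\<in>W. e \<in> N" "3 \<le> card V"
  shows "\<exists>c. hamiltonian_cycle adj V c"
proof -
  obtain c where c: "distinct c" "set c = set p \<union> (V - set p)" "successively adj c"
    "c \<noteq> [] \<longrightarrow> hd c \<in> A \<and> last c \<in> A"
    using trail_to_path[of A p A W "V - set p"] assms by auto
  have V: "set c = V" using c(2) assms(3) by auto
  have len: "3 \<le> length c" using distinct_card[OF c(1)] V assms(5) by simp
  then obtain x c' where x: "c = x # c'" "c' \<noteq> []" by (cases c) force+
  then have "last c \<noteq> hd c" using c(1) by auto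
  then have "adj (last c) (hd c)"
    using c(4) x trail_nodes[OF assms(1)] by (auto simp: adj_def)
  then show ?thesis using c V len by (auto simp: hamiltonian_cycle_def)
qed

end

section \<open>An optimal closed trail\<close>

text \<open>\<open>R\<close> stands for the nodes meeting the dominating set, \<open>v\<close> for
  the one vertex it may miss. For the graph whose edges are the elements of \<open>V\<close>,
  \<open>three_connected\<close> is essential 3-edge-connectivity. \<open>R_large\<close> provides a
  trivial admissible trail.\<close>

locale covered_line_structure = line_structure +
  fixes R :: "'a set set" and v :: 'a
  assumes nodes_exist: "e \<in> V \<Longrightarrow> \<exists>N\<in>\<N>. e \<in> N"
    and three_connected: "\<lbrakk>X \<subseteq> V; card X < 3\<rbrakk> \<Longrightarrow> cut_connected adj (V - X)"
    and R_nodes: "R \<subseteq> \<N>"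
    and card_R: "card R \<le> 5"
    and R_connected: "\<lbrakk>T \<subseteq> R; T \<noteq> {}; T \<noteq> R\<rbrakk> \<Longrightarrow> \<exists>r\<in>T. \<exists>z\<in>R - T. r \<inter> z \<noteq> {}"
    and R_covers: "\<lbrakk>e \<in> V; e \<noteq> v\<rbrakk> \<Longrightarrow> \<exists>r\<in>R. e \<in> r"
    and R_large: "\<exists>r\<in>R. 3 \<le> card r"
    and v_in: "v \<in> V"
begin

definition S :: "'a set set" where
  "S = {N \<in> \<N>. v \<in> N}"

text \<open>The factor 3 makes one node of \<open>R\<close> outweigh both ends of \<open>v\<close>.\<close>

definition score :: "'a set set \<Rightarrow> nat" where
  "score W = 3 * card (W \<inter> R) + card (W \<inter> S)"

text \<open>A trivial trail must sit at a node with three edges; this is what provides three attachments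
  when no edge is disjoint from the component under consideration.\<close>

definition admissible :: "'a set \<Rightarrow> 'a list \<Rightarrow> 'a set set \<Rightarrow> bool" where
  "admissible A p W \<longleftrightarrow> trail A p A W \<and> distinct p \<and> (p \<noteq> [] \<or> A \<in> R \<and> 3 \<le> card A)"

lemma finite_R: "finite R"
  using R_nodes finite_nodes by (rule finite_subset)

lemma card_R_le: "X \<subseteq> R \<Longrightarrow> card X \<le> 5"
  using card_mono[OF finite_R, of X] card_R by simp

lemma S_nodes: "S \<subseteq> \<N>"
  by (auto simp: S_def)

lemma finite_S: "finite S"
  using S_nodes finite_nodes by (rule finite_subset)

lemma card_S: "card S \<le> 2"
proof (rule ccontr)
  assume "\<not> card S \<le> 2"
  then have "3 \<le> card S" by simp
  then obtain T where "T \<subseteq> S" "card T = 3"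
    using obtain_subset_with_card_n by metis
  then obtain A B C where "T = {A, B, C}" "A \<noteq> B" "A \<noteq> C" "B \<noteq> C"
    by (auto simp: card_3_iff)
  then show False
    using \<open>T \<subseteq> S\<close> two_nodes[of A B C v] by (auto simp: S_def)
qed

lemma edge_in_V: "N \<in> \<N> \<Longrightarrow> e \<in> N \<Longrightarrow> e \<in> V"
  using node_subset by blast

lemma ex_optimal:
  "\<exists>A p W. admissible A p W \<and> (\<forall>A' p' W'. admissible A' p' W' \<longrightarrow> score W' \<le> score W)"
proof -
  define P where "P W \<longleftrightarrow> (\<exists>A p. admissible A p W)" for W
  obtain r where "r \<in> R" "3 \<le> card r" using R_large by blast
  then have "admissible r [] {r}"
    using R_nodes trail.Nil by (auto simp: admissible_def)
  then have "P {r}" by (auto simp: P_def)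
  \<comment> \<open>Five nodes of \<open>R\<close> and two ends of \<open>v\<close> give at most
    \<open>3 * 5 + 2\<close>, so a maximum exists.\<close>
  moreover have "score W < 18" for W
  proof -
    have "card (W \<inter> R) \<le> 5" by (rule card_R_le) simp
    moreover have "card (W \<inter> S) \<le> 2"
      using card_mono[OF finite_S, of "W \<inter> S"] card_S by simp
    ultimately show ?thesis by (simp add: score_def)
  qed
  ultimately have "\<exists>W. P W \<and> (\<forall>W'. P W' \<longrightarrow> score W' \<le> score W)"
    by (intro ex_has_greatest_nat[of P "{r}" score 18]) auto
  then obtain W A p where "admissible A p W" "\<And>W'. P W' \<Longrightarrow> score W' \<le> score W"
    unfolding P_def by blast
  then show ?thesis unfolding P_def by blast
qed

end

locale optimal_trail = covered_line_structure +
  fixes A\<^sub>0 :: "'a set" and p\<^sub>0 :: "'a list" and W :: "'a set set"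
  assumes admissible: "admissible A\<^sub>0 p\<^sub>0 W"
    and optimal: "admissible A p W' \<Longrightarrow> score W' \<le> score W"
begin

lemma closed: "trail A\<^sub>0 p\<^sub>0 A\<^sub>0 W" "distinct p\<^sub>0"
  using admissible by (auto simp: admissible_def)

lemma W_nodes: "W \<subseteq> \<N>"
  using trail_nodes[OF closed(1)] by blast

text \<open>A further node of \<open>R\<close> adds 3 to the score, while the ends of
  \<open>v\<close> can cost at most 2.\<close>

lemma no_gain:
  assumes "trail A p A W'" "distinct p" "p \<noteq> []" "W \<inter> R \<subseteq> W'"
  shows "W' \<inter> R \<subseteq> W"
proof (rule ccontr)
  assume "\<not> W' \<inter> R \<subseteq> W"
  then have "W \<inter> R \<subset> W' \<inter> R" using assms(4) by auto
  then have "card (W \<inter> R) < card (W' \<inter> R)"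
    using finite_R by (simp add: psubset_card_mono)
  moreover have "card (W \<inter> S) \<le> 2"
    using card_mono[OF finite_S, of "W \<inter> S"] card_S by simp
  ultimately have "score W < score W'" by (simp add: score_def)
  then show False using optimal[of A p W'] assms by (simp add: admissible_def)
qed

lemma no_gain_S:
  assumes "trail A p A W'" "distinct p" "p \<noteq> []" "W \<inter> R \<subseteq> W'" "W \<inter> S \<subseteq> W'"
  shows "W' \<inter> S \<subseteq> W"
proof (rule ccontr)
  assume "\<not> W' \<inter> S \<subseteq> W"
  then have "W \<inter> S \<subset> W' \<inter> S" using assms(5) by auto
  then have "card (W \<inter> S) < card (W' \<inter> S)"
    using finite_S by (simp add: psubset_card_mono)
  moreover have "card (W \<inter> R) \<le> card (W' \<inter> R)"
    using assms(4) finite_R by (intro card_mono) auto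
  ultimately have "score W < score W'" by (simp add: score_def)
  then show False using optimal[of A p W'] assms by (simp add: admissible_def)
qed

lemma rotate_to:
  assumes "a \<in> W"
  shows "\<exists>p. trail a p a W \<and> distinct p"
proof -
  obtain p1 p2 W1 W2 where s: "p\<^sub>0 = p1 @ p2" "W = W1 \<union> W2" "trail A\<^sub>0 p1 a W1" "trail a p2 A\<^sub>0 W2"
    using trail_split[OF closed(1) assms] by blast
  have "trail a (p2 @ p1) a (W2 \<union> W1)" by (rule trail_append[OF s(4,3)])
  then show ?thesis using s(1,2) closed(2) by (intro exI[of _ "p2 @ p1"]) (auto simp: Un_commute)
qed

lemma ex_R_visited: "W \<inter> R \<noteq> {}"
proof (cases "p\<^sub>0 = []")
  case True
  then show ?thesis
    using admissible trail_nodes[OF closed(1)] by (auto simp: admissible_def)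
next
  case False
  note tr = closed(1) and d = closed(2)
  have "p\<^sub>0 \<noteq> [e]" for e
    using tr by (auto elim!: trail.cases)
  \<comment> \<open>A single step changes the node, so a nonempty closed trail has two edges; one of
    them is not \<open>v\<close> and is covered by \<open>R\<close>.\<close>
  then obtain e f q where p: "p\<^sub>0 = e # f # q"
    using False by (metis list.exhaust)
  then have "e \<noteq> v \<or> f \<noteq> v" using d by auto
  then obtain g where g: "g \<in> set p\<^sub>0" "g \<noteq> v" using p by auto
  then have "g \<in> V"
    using trail_edge_in_node[OF tr] W_nodes edge_in_V by blast
  then obtain r where "r \<in> R" "g \<in> r" using R_covers g by blast
  then show ?thesis using trail_edge_nodes[OF tr g(1)] R_nodes by auto
qed

section \<open>Components of the unvisited nodes and their attachments\<close>

definition component :: "'a set \<Rightarrow> 'a set set" where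
  "component K = {Y. (\<lambda>X Y. X \<in> \<N> - W \<and> Y \<in> \<N> - W \<and> X \<inter> Y \<noteq> {})\<^sup>*\<^sup>* K Y}"

lemma self_in_component: "K \<in> component K"
  by (simp add: component_def)

lemma component_subset: "K \<in> \<N> - W \<Longrightarrow> component K \<subseteq> \<N> - W"
proof
  fix Y assume K: "K \<in> \<N> - W" "Y \<in> component K"
  from K(2) have "(\<lambda>X Y. X \<in> \<N> - W \<and> Y \<in> \<N> - W \<and> X \<inter> Y \<noteq> {})\<^sup>*\<^sup>* K Y"
    by (simp add: component_def)
  then show "Y \<in> \<N> - W" using K(1) by (induction rule: rtranclp_induct) auto
qed

lemma component_step:
  assumes "X \<in> component K" "K \<in> \<N> - W" "Y \<in> \<N>" "e \<in> X" "e \<in> Y"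
  shows "Y \<in> component K \<or> Y \<in> W"
proof -
  have "X \<in> \<N> - W" using component_subset assms by blast
  then show ?thesis
    using assms unfolding component_def
    by (auto intro: rtranclp.rtrancl_into_rtrancl)
qed

lemma component_path_from:
  assumes K: "K \<in> \<N> - W" and "X \<in> component K"
  shows "\<exists>q U. trail K q X U \<and> distinct q \<and> U \<subseteq> component K"
proof -
  have "(\<lambda>X Y. X \<in> \<N> - W \<and> Y \<in> \<N> - W \<and> X \<inter> Y \<noteq> {})\<^sup>*\<^sup>* K X"
    using assms by (simp add: component_def)
  then show ?thesis
  proof (induction rule: rtranclp_induct)
    case base
    then show ?case
      using trail.Nil[of K] K self_in_component by (intro exI[of _ "[]"] exI[of _ "{K}"]) auto
  next
    case (step X Y)
    then obtain q U where q: "trail K q X U" "distinct q" "U \<subseteq> component K" by blast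
    have Y: "Y \<in> component K"
      using step unfolding component_def by (auto intro: rtranclp.rtrancl_into_rtrancl)
    \<comment> \<open>If \<open>Y\<close> was already visited, the trail is cut there. If not, the
      edge leading to \<open>Y\<close> cannot have been used before.\<close>
    show ?case
    proof (cases "Y \<in> U")
      case True
      then obtain q1 q2 U1 U2 where "q = q1 @ q2" "U = U1 \<union> U2" "trail K q1 Y U1"
        using trail_split[OF q(1) True] by blast
      then show ?thesis using q by (intro exI[of _ q1] exI[of _ U1]) auto
    next
      case False
      obtain e where e: "e \<in> X" "e \<in> Y" using step by auto
      have XY: "X \<noteq> Y" using False trail_nodes[OF q(1)] by auto
      have "trail K (q @ [e]) Y (U \<union> {X, Y})"
        using step e XY by (intro trail_append[OF q(1)] trail_single) auto
      moreover have "e \<notin> set q"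
        using trail_edge_nodes[OF q(1), of e Y] False e step by auto
      ultimately show ?thesis
        using q Y trail_nodes[OF q(1)]
        by (intro exI[of _ "q @ [e]"] exI[of _ "U \<union> {X, Y}"]) auto
    qed
  qed
qed

lemma component_sym:
  assumes "X \<in> component K" shows "component X = component K"
proof -
  let ?r = "\<lambda>X Y. X \<in> \<N> - W \<and> Y \<in> \<N> - W \<and> X \<inter> Y \<noteq> {}"
  have "symp ?r" by (auto simp: symp_def)
  then have s: "symp ?r\<^sup>*\<^sup>*" by (rule symp_rtranclp)
  have "?r\<^sup>*\<^sup>* K X" using assms by (simp add: component_def)
  moreover from this have "?r\<^sup>*\<^sup>* X K" using s by (auto simp: symp_def)
  ultimately show ?thesis
    unfolding component_def by (auto intro: rtranclp_trans)
qed

lemma component_path: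
  assumes K: "K \<in> \<N> - W" and "h \<in> component K" "h' \<in> component K"
  shows "\<exists>q U. trail h q h' U \<and> distinct q \<and> U \<subseteq> component K"
proof -
  have "h \<in> \<N> - W" using component_subset[OF K] assms(2) by blast
  then show ?thesis
    using component_path_from[of h h'] component_sym[OF assms(2)] assms(3) by simp
qed

definition attached :: "'a set \<Rightarrow> 'a \<Rightarrow> 'a set \<Rightarrow> 'a set \<Rightarrow> bool" where
  "attached K b h a \<longleftrightarrow> h \<in> component K \<and> a \<in> W \<and> b \<in> h \<and> b \<in> a"

lemma attachedD:
  assumes "attached K b h a" "K \<in> \<N> - W"
  shows "h \<in> \<N>" "a \<in> \<N>" "h \<notin> W" "a \<in> W" "a \<noteq> h" "b \<in> V" "b \<in> h" "b \<in> a" "h \<in> component K"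
proof -
  show 1: "b \<in> h" "b \<in> a" "h \<in> component K" "a \<in> W"
    using assms(1) by (auto simp: attached_def)
  show 2: "h \<in> \<N>" "h \<notin> W" using 1 component_subset[OF assms(2)] by auto
  show "a \<in> \<N>" "a \<noteq> h" using 1 2 W_nodes by auto
  then show "b \<in> V" using 1 edge_in_V by blast
qed

text \<open>The attachment edges \<open>D\<close> separate: the other edges \<open>I\<close> meeting
  the component have no end on the trail, so only edges of \<open>D\<close> lead out of
  \<open>I\<close>. With fewer than three of them this contradicts 3-connectedness, because
  \<open>I\<close> contains \<open>e\<close> and is not all of \<open>V - D\<close>.\<close>

lemma three_attachments:
  assumes K: "K \<in> \<N> - W" and e: "e \<in> V" "\<And>N. N \<in> \<N> \<Longrightarrow> e \<in> N \<Longrightarrow> N \<in> component K"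
  shows "3 \<le> card {b. \<exists>h a. attached K b h a}"
proof (rule ccontr)
  define D where "D = {b. \<exists>h a. attached K b h a}"
  assume "\<not> 3 \<le> card {b. \<exists>h a. attached K b h a}"
  then have cD: "card D < 3" by (simp add: D_def)
  have DV: "D \<subseteq> V" using attachedD(6)[OF _ K] by (auto simp: D_def)
  define I where "I = {f \<in> V - D. \<exists>N\<in>component K. f \<in> N}"
  have I: "N \<in> component K" if f: "f \<in> I" "N \<in> \<N>" "f \<in> N" for f N
  proof -
    obtain X where X: "X \<in> component K" "f \<in> X" "f \<notin> D" using f(1) by (auto simp: I_def)
    then have "N \<notin> W" using f(3) by (auto simp: D_def attached_def)
    then show ?thesis using component_step[OF X(1) K f(2) X(2) f(3)] by blast
  qed
  have "e \<notin> D"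
    using e(2) component_subset[OF K] W_nodes by (auto simp: D_def attached_def)
  moreover obtain N where "N \<in> \<N>" "e \<in> N" using nodes_exist[OF e(1)] by blast
  ultimately have "e \<in> I" using e by (auto simp: I_def)
  \<comment> \<open>An edge of a nonempty trail has only visited ends, so it avoids \<open>D\<close>
    and \<open>I\<close>. A trivial trail sits at a node with three edges, one of which avoids
    \<open>D\<close> and hence \<open>I\<close>.\<close>
  have "I \<noteq> V - D"
  proof
    assume eq: "I = V - D"
    note tr = closed(1)
    show False
    proof (cases "p\<^sub>0 = []")
      case True
      then have W: "A\<^sub>0 \<in> W" "A\<^sub>0 \<in> \<N>" "3 \<le> card A\<^sub>0"
        using admissible trail_nodes[OF tr] by (auto simp: admissible_def)
      have "f \<in> D" if "f \<in> A\<^sub>0" for f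
        using I[of f A\<^sub>0] W that eq component_subset[OF K] edge_in_V by blast
      then have "card A\<^sub>0 \<le> card D"
        using finite_subset[OF DV finite_V] by (intro card_mono) auto
      then show False using W cD by simp
    next
      case False
      then obtain f where f: "f \<in> set p\<^sub>0" by (cases p\<^sub>0) auto
      then obtain N where N: "N \<in> W" "f \<in> N" using trail_edge_in_node[OF tr] by blast
      have "f \<notin> D"
      proof
        assume "f \<in> D"
        then obtain h a where "attached K f h a" by (auto simp: D_def)
        note d = attachedD[OF this K]
        show False using trail_edge_nodes[OF tr f d(1) d(7)] d(3) by blast
      qed
      then have "f \<in> I" using eq N W_nodes edge_in_V by blast
      then show False using I N W_nodes component_subset[OF K] by blast
    qed
  qed
  moreover have "I \<subseteq> V - D" "I \<noteq> {}" using \<open>e \<in> I\<close> by (auto simp: I_def)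
  ultimately have "\<exists>f\<in>I. \<exists>g\<in>V - D - I. adj f g"
    using three_connected[OF DV cD] by (simp add: cut_connected_def)
  then obtain f g where fg: "f \<in> I" "g \<in> V - D - I" "adj f g" by blast
  then obtain N where "N \<in> \<N>" "f \<in> N" "g \<in> N" by (auto simp: adj_def)
  then show False using I[of f N] fg by (auto simp: I_def)
qed

text \<open>The edges of \<open>q\<close> have no visited end, so they differ from \<open>b\<close>
  and \<open>b'\<close>. The case \<open>a = a'\<close> is allowed and gives a closed
  detour.\<close>

lemma detour:
  assumes K: "K \<in> \<N> - W" and att: "attached K b h a" "attached K b' h' a'" and b: "b \<noteq> b'"
  obtains q U Q where "trail h q h' U" "Q = b # q @ [b']" "trail a Q a' ({a, a'} \<union> U)"
    "distinct Q" "U \<subseteq> component K" "h \<in> U" "h' \<in> U" "\<forall>e\<in>set Q. \<exists>N\<in>component K. e \<in> N"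
proof -
  note d = attachedD[OF att(1) K] and d' = attachedD[OF att(2) K]
  obtain q U where q: "trail h q h' U" "distinct q" "U \<subseteq> component K"
    using component_path[OF K d(9) d'(9)] by blast
  have hU: "h \<in> U" "h' \<in> U" using trail_nodes[OF q(1)] by auto
  have nq: "e \<notin> set q" if "e \<in> N" "N \<in> W" for e N
    using trail_edge_nodes[OF q(1), of e N] that W_nodes q(3) component_subset[OF K] by blast
  have "trail h (q @ [b']) a' (U \<union> {h', a'})"
    using d' by (intro trail_append[OF q(1)] trail_single) auto
  then have "trail a (b # q @ [b']) a' (insert a (U \<union> {h', a'}))"
    using d by (intro trail.Cons) auto
  moreover have "insert a (U \<union> {h', a'}) = {a, a'} \<union> U" using hU by auto
  ultimately have t: "trail a (b # q @ [b']) a' ({a, a'} \<union> U)" by simp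
  have "distinct (b # q @ [b'])"
    using nq[OF d(8,4)] nq[OF d'(8,4)] b q(2) by auto
  moreover have "\<exists>N\<in>component K. e \<in> N" if "e \<in> set (b # q @ [b'])" for e
    using that d(7,9) d'(7,9) trail_edge_in_node[OF q(1)] q(3) by auto
  ultimately show thesis using that[OF q(1) refl t] q(3) hU by blast
qed

lemma detour_disjoint:
  assumes K: "K \<in> \<N> - W" and Q: "\<forall>e\<in>set Q. \<exists>N\<in>component K. e \<in> N"
    and "trail A P B W'" "W' \<subseteq> W"
  shows "set Q \<inter> set P = {}"
proof (rule ccontr)
  assume "set Q \<inter> set P \<noteq> {}"
  then obtain e where e: "e \<in> set Q" "e \<in> set P" by blast
  then obtain N where N: "N \<in> component K" "e \<in> N" using Q by blast
  then have "N \<in> \<N> - W" using component_subset[OF K] by blast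
  then show False using trail_edge_nodes[OF assms(3) e(2) _ N(2)] assms(4) by blast
qed

text \<open>A closed detour at \<open>a\<close> could be added to the trail without loss. Two nodes
  share at most one edge, so \<open>h\<close> and \<open>h'\<close> differ and the detour has an
  edge inside the component. That edge is \<open>v\<close> or lies in a node of \<open>R\<close>;
  either way the score grows.\<close>

lemma attachments_distinct:
  assumes K: "K \<in> \<N> - W" and att: "attached K b h a" "attached K b' h' a" and b: "b \<noteq> b'"
  shows False
proof -
  note d = attachedD[OF att(1) K] and d' = attachedD[OF att(2) K]
  obtain q U Q where Q: "trail h q h' U" "Q = b # q @ [b']" "trail a Q a ({a, a} \<union> U)"
    "distinct Q" "U \<subseteq> component K" "h \<in> U" "h' \<in> U" "\<forall>e\<in>set Q. \<exists>N\<in>component K. e \<in> N"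
    by (rule detour[OF K att b])
  obtain p where p: "trail a p a W" "distinct p" using rotate_to d(4) by blast
  have disj: "set Q \<inter> set p = {}" using detour_disjoint[OF K Q(8) p(1)] by blast
  have "h \<noteq> h'" using linear[of h a b b'] d d' b by auto
  then have "q \<noteq> []" using Q(1) by (auto elim: trail.cases)
  then obtain e where e: "e \<in> set q" by (cases q) auto
  obtain N where N: "N \<in> U" "e \<in> N" using trail_edge_in_node[OF Q(1) e] by blast
  have new: "trail a (p @ Q) a (W \<union> ({a, a} \<union> U))" "distinct (p @ Q)" "p @ Q \<noteq> []"
    using trail_append[OF p(1) Q(3)] p(2) Q(2,4) disj by auto
  have UW: "U \<inter> W = {}" "U \<subseteq> \<N>" using Q(5) component_subset[OF K] by auto
  show False
  proof (cases "e = v")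
    case True
    then have "N \<in> S" using N UW by (auto simp: S_def)
    then show False using no_gain_S[OF new] N UW by auto
  next
    case False
    then obtain r where r: "r \<in> R" "e \<in> r" using R_covers N UW edge_in_V by blast
    then have "r \<in> U" using trail_edge_nodes[OF Q(1) e] R_nodes by auto
    then show False using no_gain[OF new] r UW by auto
  qed
qed

text \<open>Replacing the part \<open>P\<close> of the closed trail by a detour through an unvisited component loses
  a node of \<open>R\<close>, except in the situation described in the conclusion.\<close>

lemma bypass:
  assumes K: "K \<in> \<N> - W" and att: "attached K b h a" "attached K b' h' a'" and b: "b \<noteq> b'"
    and P: "trail a P a' W1" "trail a' P' a W2" "distinct P'" "W = W1 \<union> W2"
    and keep: "W \<inter> R \<subseteq> W2"
  shows "a \<in> R \<and> a' \<in> R \<and> h \<notin> R \<and> h' \<notin> R \<and> (W \<inter> S = {} \<longrightarrow> h \<notin> S)"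
proof -
  note d = attachedD[OF att(1) K] and d' = attachedD[OF att(2) K]
  obtain q U Q where Q: "trail h q h' U" "Q = b # q @ [b']" "trail a Q a' ({a, a'} \<union> U)"
    "distinct Q" "U \<subseteq> component K" "h \<in> U" "h' \<in> U" "\<forall>e\<in>set Q. \<exists>N\<in>component K. e \<in> N"
    by (rule detour[OF K att b])
  have disj: "set Q \<inter> set P' = {}" using detour_disjoint[OF K Q(8) P(2)] P(4) by blast
  have new: "trail a (Q @ P') a ({a, a'} \<union> U \<union> W2)" "distinct (Q @ P')" "Q @ P' \<noteq> []"
    using trail_append[OF Q(3) P(2)] P(3) Q(2,4) disj by auto
  have keep': "W \<inter> R \<subseteq> {a, a'} \<union> U \<union> W2" using keep by auto
  have hR: "h \<notin> R" "h' \<notin> R" using no_gain[OF new keep'] Q(6,7) d(3) d'(3) by auto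
  have S: "\<not> (W \<inter> S \<subseteq> {a, a'} \<union> U \<union> W2 \<and> (h \<in> S \<or> h' \<in> S))"
    using no_gain_S[OF new keep'] Q(6,7) d(3) d'(3) by auto
  \<comment> \<open>If \<open>v\<close> has an unvisited end, it has at most one visited end. So if
    \<open>b\<close> or \<open>b'\<close> were \<open>v\<close>, the detour would keep that end and
    gain a new one. Hence both edges are covered by \<open>R\<close>, necessarily at
    \<open>a\<close> and \<open>a'\<close>.\<close>
  have Sub: "W \<inter> S \<subseteq> {x}" if "v \<in> g" "v \<in> x" "g \<in> \<N> - W" "x \<in> \<N>" "x \<noteq> g" for g x
    using two_nodes[of g x _ v] that by (auto simp: S_def)
  have "b \<noteq> v"
    using Sub[of h a] S d by (auto simp: S_def)
  then obtain r where r: "r \<in> R" "b \<in> r" using R_covers d by blast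
  then have "r = h \<or> r = a" using two_nodes[of r h a b] d R_nodes by auto
  then have "a \<in> R" using r hR by auto
  moreover have "b' \<noteq> v"
    using Sub[of h' a'] S d' by (auto simp: S_def)
  then obtain r' where r': "r' \<in> R" "b' \<in> r'" using R_covers d' by blast
  then have "r' = h' \<or> r' = a'" using two_nodes[of r' h' a' b'] d' R_nodes by auto
  then have "a' \<in> R" using r' hR by auto
  ultimately show ?thesis using hR S by auto
qed

end

section \<open>An optimal closed trail meets every edge\<close>

context optimal_trail
begin

section \<open>Cutting the trail at three attachment nodes\<close>

definition pieces where
  "pieces a1 a2 a3 P1 P2 P3 W1 W2 W3 \<longleftrightarrow>
     trail a1 P1 a2 W1 \<and> trail a2 P2 a3 W2 \<and> trail a3 P3 a1 W3 \<and>
     distinct (P1 @ P2 @ P3) \<and> W = W1 \<union> W2 \<union> W3"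

text \<open>Starting from \<open>a1\<close>, the node \<open>a3\<close> is found after or before
  \<open>a2\<close>; this decides the cyclic order.\<close>

lemma ex_pieces:
  assumes "a1 \<in> W" "a2 \<in> W" "a3 \<in> W"
  shows "(\<exists>P1 P2 P3 W1 W2 W3. pieces a1 a2 a3 P1 P2 P3 W1 W2 W3) \<or>
    (\<exists>P1 P2 P3 W1 W2 W3. pieces a1 a3 a2 P1 P2 P3 W1 W2 W3)"
proof -
  obtain p where p: "trail a1 p a1 W" "distinct p" using rotate_to assms(1) by blast
  obtain p1 p2 W1 W2 where s: "p = p1 @ p2" "W = W1 \<union> W2" "trail a1 p1 a2 W1" "trail a2 p2 a1 W2"
    using trail_split[OF p(1) assms(2)] by blast
  show ?thesis
  proof (cases "a3 \<in> W2")
    case True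
    obtain q1 q2 U1 U2 where t: "p2 = q1 @ q2" "W2 = U1 \<union> U2" "trail a2 q1 a3 U1" "trail a3 q2 a1 U2"
      using trail_split[OF s(4) True] by blast
    then have "pieces a1 a2 a3 p1 q1 q2 W1 U1 U2"
      unfolding pieces_def using s t p by auto
    then show ?thesis by blast
  next
    case False
    then have "a3 \<in> W1" using assms(3) s(2) by auto
    obtain q1 q2 U1 U2 where t: "p1 = q1 @ q2" "W1 = U1 \<union> U2" "trail a1 q1 a3 U1" "trail a3 q2 a2 U2"
      using trail_split[OF s(3) \<open>a3 \<in> W1\<close>] by blast
    then have "pieces a1 a3 a2 q1 q2 p2 U1 U2 W2"
      unfolding pieces_def using s t p by auto
    then show ?thesis by blast
  qed
qed

lemma pieces_rotate:
  assumes "pieces a1 a2 a3 P1 P2 P3 W1 W2 W3"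
  shows "pieces a2 a3 a1 P2 P3 P1 W2 W3 W1"
  using assms unfolding pieces_def by auto

text \<open>A piece without a private node of \<open>R\<close> could be bypassed without losing
  \<open>R\<close>; each alternative in \<open>hyp\<close> contradicts the conclusion of
  \<open>bypass\<close>.\<close>

lemma bypass_piece:
  assumes K: "K \<in> \<N> - W" and att: "attached K b h a1" "attached K b' h' a2" "b \<noteq> b'"
    and P: "pieces a1 a2 a3 P1 P2 P3 W1 W2 W3"
    and hyp: "a1 \<notin> R \<or> a2 \<notin> R \<or> h \<in> R \<or> h' \<in> R \<or> (W \<inter> S = {} \<and> h \<in> S)"
  shows "\<exists>r\<in>R. r \<in> W1 \<and> r \<notin> W2 \<and> r \<notin> W3"
proof (rule ccontr)
  assume "\<not> (\<exists>r\<in>R. r \<in> W1 \<and> r \<notin> W2 \<and> r \<notin> W3)"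
  then have keep: "W \<inter> R \<subseteq> W2 \<union> W3" using P unfolding pieces_def by blast
  have "trail a1 P1 a2 W1" "trail a2 (P2 @ P3) a1 (W2 \<union> W3)" "distinct (P2 @ P3)" "W = W1 \<union> (W2 \<union> W3)"
    using P trail_append unfolding pieces_def by auto
  from bypass[OF K att this keep] show False using hyp by auto
qed

lemma pieces_ends:
  assumes "pieces a1 a2 a3 P1 P2 P3 W1 W2 W3"
  shows "a1 \<in> W1" "a2 \<in> W1" "a2 \<in> W2" "a3 \<in> W2" "a3 \<in> W3" "a1 \<in> W3"
  using assms trail_nodes[of a1 P1 a2 W1] trail_nodes[of a2 P2 a3 W2] trail_nodes[of a3 P3 a1 W3]
  by (auto simp: pieces_def)

text \<open>The component at \<open>v\<close> consists of ends of \<open>v\<close>, none of them in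
  \<open>R\<close>. So every attachment edge is covered by \<open>R\<close> at its visited end, and
  three such ends with three private nodes exceed the bound 5.\<close>

lemma only_v_uncovered:
  assumes unc: "\<And>e r. \<lbrakk>e \<in> V; \<And>N. N \<in> W \<Longrightarrow> e \<notin> N; r \<in> R\<rbrakk> \<Longrightarrow> e \<notin> r"
    and v: "\<And>N. N \<in> W \<Longrightarrow> v \<notin> N"
  shows False
proof -
  have SW: "S \<inter> W = {}" using v by (auto simp: S_def)
  have SR: "S \<inter> R = {}" using unc[OF v_in v] by (auto simp: S_def)
  obtain K where K: "K \<in> \<N>" "v \<in> K" using nodes_exist[OF v_in] by blast
  then have KW: "K \<in> \<N> - W" using v by blast
  \<comment> \<open>An edge between two unvisited nodes is missed by the trail and so lies in no
    node of \<open>R\<close>.\<close>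
  have uncovered: "e = v" if "X \<in> \<N> - W" "Y \<in> \<N> - W" "X \<noteq> Y" "e \<in> X" "e \<in> Y" for e X Y
  proof (rule ccontr)
    assume "e \<noteq> v"
    have "e \<in> V" using that edge_in_V by blast
    then obtain r where "r \<in> R" "e \<in> r" using R_covers \<open>e \<noteq> v\<close> by blast
    moreover have "e \<notin> N" if "N \<in> W" for N
      using two_nodes[of X Y N e] \<open>N \<in> W\<close> W_nodes \<open>X \<in> \<N> - W\<close> \<open>Y \<in> \<N> - W\<close> \<open>X \<noteq> Y\<close> \<open>e \<in> X\<close> \<open>e \<in> Y\<close> by blast
    ultimately show False using unc[OF \<open>e \<in> V\<close>] by blast
  qed
  have comp: "component K \<subseteq> S"
  proof
    fix Y assume "Y \<in> component K"
    then have "(\<lambda>X Y. X \<in> \<N> - W \<and> Y \<in> \<N> - W \<and> X \<inter> Y \<noteq> {})\<^sup>*\<^sup>* K Y"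
      by (simp add: component_def)
    then show "Y \<in> S"
    proof (induction rule: rtranclp_induct)
      case base
      then show ?case using K by (simp add: S_def)
    next
      case (step X Y)
      then obtain e where "e \<in> X" "e \<in> Y" by blast
      then show ?case using uncovered[of X Y e] step by (cases "X = Y") (auto simp: S_def)
    qed
  qed
  have "N \<in> component K" if "N \<in> \<N>" "v \<in> N" for N
    using component_step[OF self_in_component KW that(1) K(2) that(2)] v that by blast
  then have "3 \<le> card {b. \<exists>h a. attached K b h a}"
    using three_attachments[OF KW v_in] by blast
  then obtain T where T: "T \<subseteq> {b. \<exists>h a. attached K b h a}" "card T = 3"
    using obtain_subset_with_card_n by metis
  then obtain b1 b2 b3 where b: "T = {b1, b2, b3}" "b1 \<noteq> b2" "b1 \<noteq> b3" "b2 \<noteq> b3"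
    by (auto simp: card_3_iff)
  have att_R: "a \<in> R" and att_S: "h \<in> S" if att: "attached K b h a" for b h a
  proof -
    note d = attachedD[OF att KW]
    show "h \<in> S" using d comp by blast
    have "b \<noteq> v" using v d by blast
    then obtain r where r: "r \<in> R" "b \<in> r" using R_covers d by blast
    then have "r = h \<or> r = a" using two_nodes[of r h a b] d R_nodes by auto
    then show "a \<in> R" using r SR \<open>h \<in> S\<close> by blast
  qed
  have contra: False
    if att: "attached K b1 h1 a1" "attached K b2 h2 a2" "attached K b3 h3 a3"
      and b: "b1 \<noteq> b2" "b1 \<noteq> b3" "b2 \<noteq> b3"
      and P: "pieces a1 a2 a3 P1 P2 P3 W1 W2 W3"
    for b1 b2 b3 h1 h2 h3 a1 a2 a3 P1 P2 P3 W1 W2 W3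
  proof -
    note e = pieces_ends[OF P]
    have WS: "W \<inter> S = {}" using SW by blast
    obtain r12 where r12: "r12 \<in> R" "r12 \<in> W1" "r12 \<notin> W2" "r12 \<notin> W3"
      using bypass_piece[OF KW att(1,2) b(1) P] WS att_S[OF att(1)] by blast
    obtain r23 where r23: "r23 \<in> R" "r23 \<in> W2" "r23 \<notin> W3" "r23 \<notin> W1"
      using bypass_piece[OF KW att(2,3) b(3) pieces_rotate[OF P]] WS att_S[OF att(2)] by blast
    obtain r31 where r31: "r31 \<in> R" "r31 \<in> W3" "r31 \<notin> W1" "r31 \<notin> W2"
      using bypass_piece[OF KW att(3,1) b(2)[symmetric] pieces_rotate[OF pieces_rotate[OF P]]]
        WS att_S[OF att(3)] by blast
    have a: "a1 \<noteq> a2" "a1 \<noteq> a3" "a2 \<noteq> a3"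
      using attachments_distinct[OF KW] att b by metis+
    have "a1 \<noteq> r12" "a2 \<noteq> r12" "a3 \<noteq> r12" "a1 \<noteq> r23" "a2 \<noteq> r23" "a3 \<noteq> r23"
      "a1 \<noteq> r31" "a2 \<noteq> r31" "a3 \<noteq> r31" "r12 \<noteq> r23" "r12 \<noteq> r31" "r23 \<noteq> r31"
      using e r12 r23 r31 by metis+
    then have "card {a1, a2, a3, r12, r23, r31} = 6" using a by simp
    moreover have "{a1, a2, a3, r12, r23, r31} \<subseteq> R"
      using att_R att r12 r23 r31 by blast
    ultimately show False using card_R_le[of "{a1, a2, a3, r12, r23, r31}"] by simp
  qed
  have ex: "\<exists>h a. attached K b h a" if "b \<in> {b1, b2, b3}" for b
    using T(1) b(1) that by auto
  obtain h1 a1 where att1: "attached K b1 h1 a1" using ex[of b1] by auto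
  obtain h2 a2 where att2: "attached K b2 h2 a2" using ex[of b2] by auto
  obtain h3 a3 where att3: "attached K b3 h3 a3" using ex[of b3] by auto
  have "a1 \<in> W" "a2 \<in> W" "a3 \<in> W" using att1 att2 att3 by (auto simp: attached_def)
  from ex_pieces[OF this] show False
    using contra[OF att1 att2 att3 b(2-4)] contra[OF att1 att3 att2 b(3,2) b(4)[symmetric]]
    by (elim disjE exE)
qed

text \<open>Three attachment nodes, one private node for each of the three parts of the trail and \<open>K\<close>
  exceed the bound \<open>card R \<le> 5\<close> unless all inequalities are tight.\<close>

lemma tight:
  assumes K: "K \<in> \<N> - W" "K \<in> R" and a1: "a1 \<in> R"
    and att: "attached K b1 K a1" "attached K b2 h2 a2" "attached K b3 h3 a3"
    and b: "b1 \<noteq> b2" "b1 \<noteq> b3" "b2 \<noteq> b3"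
    and P: "pieces a1 a2 a3 P1 P2 P3 W1 W2 W3"
  obtains r12 r23 r31 where "r12 \<in> W1" "r12 \<notin> W2" "r12 \<notin> W3" "r23 \<in> W2" "r23 \<notin> W3" "r23 \<notin> W1"
    "r31 \<in> W3" "r31 \<notin> W1" "r31 \<notin> W2" "R = {a1, r12, r23, r31, K}" "a2 \<notin> R" "a3 \<notin> R"
proof -
  note e = pieces_ends[OF P]
  have W: "W = W1 \<union> W2 \<union> W3" using P by (simp add: pieces_def)
  obtain r12 where r12: "r12 \<in> R" "r12 \<in> W1" "r12 \<notin> W2" "r12 \<notin> W3"
    using bypass_piece[OF K(1) att(1,2) b(1) P] K(2) by blast
  obtain r31 where r31: "r31 \<in> R" "r31 \<in> W3" "r31 \<notin> W1" "r31 \<notin> W2"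
    using bypass_piece[OF K(1) att(3,1) b(2)[symmetric] pieces_rotate[OF pieces_rotate[OF P]]]
      K(2) by blast
  have a: "a1 \<noteq> a2" "a1 \<noteq> a3" "a2 \<noteq> a3"
    using attachments_distinct[OF K(1)] att b by metis+
  have KW: "K \<notin> W1" "K \<notin> W2" "K \<notin> W3" using K(1) W by auto
  have ne: "a1 \<noteq> r12" "a2 \<noteq> r12" "a3 \<noteq> r12" "a1 \<noteq> r31" "a2 \<noteq> r31" "a3 \<noteq> r31" "r12 \<noteq> r31"
    "K \<noteq> a1" "K \<noteq> a2" "K \<noteq> a3" "K \<noteq> r12" "K \<noteq> r31"
    using e r12 r31 KW by metis+
  \<comment> \<open>Six nodes would be too many for \<open>R\<close>. That one of
    \<open>a2, a3\<close> is outside \<open>R\<close> is what yields a private node of the middle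
    piece, whose detour need not pass through \<open>K\<close>.\<close>
  have "\<not> (a2 \<in> R \<and> a3 \<in> R)"
  proof
    assume "a2 \<in> R \<and> a3 \<in> R"
    then have "{a1, a2, a3, r12, r31, K} \<subseteq> R" using a1 r12 r31 K by blast
    moreover have "card {a1, a2, a3, r12, r31, K} = 6" using a ne by simp
    ultimately show False using card_R_le[of "{a1, a2, a3, r12, r31, K}"] by simp
  qed
  then obtain r23 where r23: "r23 \<in> R" "r23 \<in> W2" "r23 \<notin> W3" "r23 \<notin> W1"
    using bypass_piece[OF K(1) att(2,3) b(3) pieces_rotate[OF P]] by blast
  have ne': "a1 \<noteq> r23" "a2 \<noteq> r23" "a3 \<noteq> r23" "r12 \<noteq> r23" "r31 \<noteq> r23" "K \<noteq> r23"
    using e r12 r23 r31 KW by metis+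
  have "card {a1, r12, r23, r31, K} = 5" using ne ne' by simp
  moreover have sub: "{a1, r12, r23, r31, K} \<subseteq> R" using a1 r12 r23 r31 K by blast
  ultimately have R: "R = {a1, r12, r23, r31, K}"
    using card_R card_mono[OF finite_R sub] card_subset_eq[OF finite_R sub] by simp
  have "a2 \<notin> R" "a3 \<notin> R" unfolding R using a ne ne' by simp_all
  then show thesis
    using that[OF r12(2-4) r23(2-4) r31(2-4) R] by simp
qed

text \<open>\<open>tight\<close> applies in either cyclic order. With \<open>r23\<close> in the role
  of \<open>a2\<close>, this will exclude an edge between \<open>K\<close> and
  \<open>r23\<close>.\<close>

lemma other_attachments_not_R:
  assumes K: "K \<in> \<N> - W" "K \<in> R" and a1: "a1 \<in> R"
    and att: "attached K b1 K a1" "attached K b2 h2 a2" "attached K b3 h3 a3"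
    and b: "b1 \<noteq> b2" "b1 \<noteq> b3" "b2 \<noteq> b3"
  shows "a2 \<notin> R"
proof -
  have "a1 \<in> W" "a2 \<in> W" "a3 \<in> W" using att by (auto simp: attached_def)
  from ex_pieces[OF this] show ?thesis
  proof
    assume "\<exists>P1 P2 P3 W1 W2 W3. pieces a1 a2 a3 P1 P2 P3 W1 W2 W3"
    then obtain P1 P2 P3 W1 W2 W3 where P: "pieces a1 a2 a3 P1 P2 P3 W1 W2 W3" by blast
    show ?thesis by (rule tight[OF K a1 att b P])
  next
    assume "\<exists>P1 P2 P3 W1 W2 W3. pieces a1 a3 a2 P1 P2 P3 W1 W2 W3"
    then obtain P1 P2 P3 W1 W2 W3 where P: "pieces a1 a3 a2 P1 P2 P3 W1 W2 W3" by blast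
    show ?thesis by (rule tight[OF K a1 att(1,3,2) b(2,1) b(3)[symmetric] P])
  qed
qed

lemma R_not_all_visited:
  assumes "K \<in> R - W" "trail A p A W'" "distinct p" "p \<noteq> []" "R \<subseteq> W'"
  shows False
  using no_gain[OF assms(2-4)] assms by blast

text \<open>An edge \<open>f\<close> from \<open>r23\<close> to a further node \<open>z\<close> of
  \<open>R\<close>, together with a detour through \<open>K\<close>, gives a closed trail visiting
  all of \<open>R\<close>.\<close>

lemma missing_node:
  assumes K: "K \<in> \<N> - W" "K \<in> R" and a1: "a1 \<in> R"
    and att: "attached K b1 K a1" "attached K b2 h2 a2" "attached K b3 h3 a3"
    and b: "b1 \<noteq> b2" "b1 \<noteq> b3" "b2 \<noteq> b3"
    and P: "pieces a1 a2 a3 P1 P2 P3 W1 W2 W3"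
  shows False
proof -
  note e = pieces_ends[OF P]
  have W: "W = W1 \<union> W2 \<union> W3" and dist: "distinct (P1 @ P2 @ P3)"
    and tr: "trail a1 P1 a2 W1" "trail a2 P2 a3 W2" "trail a3 P3 a1 W3"
    using P unfolding pieces_def by auto
  obtain r12 r23 r31 where r12: "r12 \<in> W1" "r12 \<notin> W2" "r12 \<notin> W3"
    and r23: "r23 \<in> W2" "r23 \<notin> W3" "r23 \<notin> W1"
    and r31: "r31 \<in> W3" "r31 \<notin> W1" "r31 \<notin> W2"
    and R: "R = {a1, r12, r23, r31, K}" and aR: "a2 \<notin> R" "a3 \<notin> R"
    by (rule tight[OF K a1 att b P])
  note d1 = attachedD[OF att(1) K(1)] and d2 = attachedD[OF att(2) K(1)]
  have KW: "K \<in> R - W" using K by blast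
  have K_only: "h = K" if "h \<in> R" "h \<in> component K" for h
    using that R component_subset[OF K(1)] e r12 r23 r31 W by auto
  \<comment> \<open>One of \<open>b2, b3\<close> is not \<open>v\<close>, hence covered by
    \<open>R\<close>, and not at \<open>a2\<close> or \<open>a3\<close>. The only node of
    \<open>R\<close> in the component is \<open>K\<close>. So the detour from \<open>a3\<close> to
    \<open>a2\<close> visits \<open>K\<close>.\<close>
  have h23: "h2 = K \<or> h3 = K"
  proof -
    have *: "h = K" if att: "attached K b h a" and "b \<noteq> v" "a \<notin> R" for b h a
    proof -
      note d = attachedD[OF att K(1)]
      obtain r where r: "r \<in> R" "b \<in> r" using R_covers d \<open>b \<noteq> v\<close> by blast
      then have "r = h \<or> r = a" using two_nodes[of r h a b] d R_nodes by auto
      then show ?thesis using K_only r \<open>a \<notin> R\<close> d by blast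
    qed
    show ?thesis using *[OF att(2)] *[OF att(3)] aR b(3) by blast
  qed
  \<comment> \<open>Otherwise \<open>a1\<close> cuts the middle piece in two. Bypassing either part
    through \<open>K\<close> must lose a node of \<open>R\<close>, which can only be
    \<open>r23\<close>; so \<open>r23\<close> would lie in neither part.\<close>
  have a1_W2: "a1 \<notin> W2"
  proof
    assume a1W2: "a1 \<in> W2"
    obtain q1 q2 U1 U2 where s: "P2 = q1 @ q2" "W2 = U1 \<union> U2" "trail a2 q1 a1 U1" "trail a1 q2 a3 U2"
      using trail_split[OF tr(2) a1W2] by blast
    have "trail a1 (q2 @ P3 @ P1) a2 (U2 \<union> (W3 \<union> W1))"
      by (intro trail_append[OF s(4)] trail_append[OF tr(3)] tr(1))
    then have "\<not> W \<inter> R \<subseteq> U2 \<union> (W3 \<union> W1)"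
      using bypass[OF K(1) att(2,1) b(1)[symmetric] s(3), of "q2 @ P3 @ P1" "U2 \<union> (W3 \<union> W1)"]
        dist s W K(2) by auto
    then have "r23 \<notin> U2" using R K(1) W e r12 r31 by auto
    have "trail a3 (P3 @ P1 @ q1) a1 (W3 \<union> (W1 \<union> U1))"
      by (intro trail_append[OF tr(3)] trail_append[OF tr(1)] s(3))
    then have "\<not> W \<inter> R \<subseteq> W3 \<union> (W1 \<union> U1)"
      using bypass[OF K(1) att(1,3) b(2) s(4), of "P3 @ P1 @ q1" "W3 \<union> (W1 \<union> U1)"]
        dist s W K(2) by auto
    then have "r23 \<notin> U1" using R K(1) W e r12 r31 by auto
    then show False using \<open>r23 \<notin> U2\<close> r23 s by blast
  qed
  have "{r23} \<subseteq> R" "{r23} \<noteq> R" using R e(1) r23(3) by auto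
  then obtain z f where z: "z \<in> R" "z \<noteq> r23" and f: "f \<in> r23" "f \<in> z"
    using R_connected[of "{r23}"] by blast
  have nodes: "r23 \<in> \<N>" "z \<in> \<N>" using z R R_nodes by auto
  have "z \<noteq> K"
  proof
    assume "z = K"
    have rW: "r23 \<in> W" using W r23 by blast
    have "attached K f K r23"
      using f rW self_in_component \<open>z = K\<close> by (simp add: attached_def)
    moreover have "b1 \<noteq> f"
      using two_nodes[of K a1 r23 f] f \<open>z = K\<close> nodes d1 rW r23 e by auto
    moreover have "f \<noteq> b2"
      using two_nodes[of K a2 r23 f] f \<open>z = K\<close> nodes d2 d1 rW r23 e by auto
    ultimately have "r23 \<notin> R"
      using other_attachments_not_R[OF K a1 att(1) _ att(2)] b(1) by blast
    then show False using R by blast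
  qed
  then have z3: "z = a1 \<or> z = r12 \<or> z = r31" using z R by blast
  then have zW: "z \<in> W" using W e r12 r31 by blast
  \<comment> \<open>\<open>r23\<close> is private to the middle piece and \<open>z\<close> is not on
    it, so no piece contains both ends of \<open>f\<close>.\<close>
  have fP: "f \<notin> set P1" "f \<notin> set P2" "f \<notin> set P3"
    using trail_edge_nodes[OF tr(1), of f r23] trail_edge_nodes[OF tr(2), of f z]
      trail_edge_nodes[OF tr(3), of f r23] f nodes r23 z3 a1_W2 r12 r31 by auto
  have fQ: "f \<notin> set Q" if Q: "\<forall>e\<in>set Q. \<exists>N\<in>component K. e \<in> N" for Q
  proof
    assume "f \<in> set Q"
    then obtain N where N: "N \<in> component K" "f \<in> N" using Q by blast
    then have "N \<in> \<N> - W" using component_subset[OF K(1)] by blast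
    then show False using two_nodes[of r23 z N f] nodes f N z r23 zW W by blast
  qed
  have trf: "trail r23 [f] z {r23, z}" using nodes z f by (intro trail_single) auto
  obtain P2a P2b W2a W2b where s2: "P2 = P2a @ P2b" "W2 = W2a \<union> W2b"
    "trail a2 P2a r23 W2a" "trail r23 P2b a3 W2b"
    using trail_split[OF tr(2) r23(1)] by blast
  obtain P1a P1b W1a W1b where s1: "P1 = P1a @ P1b" "W1 = W1a \<union> W1b"
    "trail a1 P1a r12 W1a" "trail r12 P1b a2 W1b"
    using trail_split[OF tr(1) r12(1)] by blast
  obtain P3a P3b W3a W3b where s3: "P3 = P3a @ P3b" "W3 = W3a \<union> W3b"
    "trail a3 P3a r31 W3a" "trail r31 P3b a1 W3b"
    using trail_split[OF tr(3) r31(1)] by blast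
  have disjQ: "set Q \<inter> set P1 = {}" "set Q \<inter> set P2 = {}" "set Q \<inter> set P3 = {}"
    if Q: "\<forall>e\<in>set Q. \<exists>N\<in>component K. e \<in> N" for Q
  proof -
    have "W1 \<subseteq> W" "W2 \<subseteq> W" "W3 \<subseteq> W" using W by auto
    then show "set Q \<inter> set P1 = {}" "set Q \<inter> set P2 = {}" "set Q \<inter> set P3 = {}"
      using detour_disjoint[OF K(1) Q tr(1)] detour_disjoint[OF K(1) Q tr(2)]
        detour_disjoint[OF K(1) Q tr(3)] by auto
  qed
  obtain q U Q where Q: "trail h3 q h2 U" "Q = b3 # q @ [b2]" "trail a3 Q a2 ({a3, a2} \<union> U)"
    "distinct Q" "U \<subseteq> component K" "h3 \<in> U" "h2 \<in> U" "\<forall>e\<in>set Q. \<exists>N\<in>component K. e \<in> N"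
    by (rule detour[OF K(1) att(3,2) b(3)[symmetric]])
  have KU: "K \<in> U" using h23 Q by blast
  note dQ = disjQ[OF Q(8)] fQ[OF Q(8)]
  obtain q' U' Q' where Q': "trail K q' h2 U'" "Q' = b1 # q' @ [b2]" "trail a1 Q' a2 ({a1, a2} \<union> U')"
    "distinct Q'" "U' \<subseteq> component K" "K \<in> U'" "h2 \<in> U'" "\<forall>e\<in>set Q'. \<exists>N\<in>component K. e \<in> N"
    by (rule detour[OF K(1) att(1,2) b(1)])
  note dQ' = disjQ[OF Q'(8)] fQ[OF Q'(8)]
  from z3 show False
  proof (elim disjE)
    assume z: "z = r12"
    \<comment> \<open>Route: from \<open>a3\<close> through \<open>K\<close> to \<open>a2\<close>,
      on to \<open>r23\<close>, over \<open>f\<close> to \<open>r12\<close>, back to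
      \<open>a1\<close>, and through \<open>r31\<close> to \<open>a3\<close>.\<close>
    have "trail a3 (Q @ P2a @ [f] @ rev P1a @ rev P3) a3 (({a3, a2} \<union> U) \<union> (W2a \<union> ({r23, z} \<union> (W1a \<union> W3))))"
      using z by (intro trail_append[OF Q(3)] trail_append[OF s2(3)] trail_append[OF trf]
          trail_append[OF trail_rev[OF s1(3), folded z]] trail_rev[OF tr(3)])
    moreover have "distinct (Q @ P2a @ [f] @ rev P1a @ rev P3)"
      using Q(4) dQ dist s1(1) s2(1) fP by auto
    moreover have "R \<subseteq> ({a3, a2} \<union> U) \<union> (W2a \<union> ({r23, z} \<union> (W1a \<union> W3)))"
      using R KU z e r31 by auto
    ultimately show False using R_not_all_visited[OF KW] by blast
  next
    assume z: "z = r31"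
    have trf': "trail z [f] r23 {r23, z}" using trail_rev[OF trf] by simp
    \<comment> \<open>Route: from \<open>a3\<close> through \<open>K\<close> to \<open>a2\<close>,
      back through \<open>r12\<close> to \<open>a1\<close> and \<open>r31\<close>, over
      \<open>f\<close> to \<open>r23\<close>, and on to \<open>a3\<close>.\<close>
    have "trail a3 (Q @ rev P1 @ rev P3b @ [f] @ P2b) a3 (({a3, a2} \<union> U) \<union> (W1 \<union> (W3b \<union> ({r23, z} \<union> W2b))))"
      by (intro trail_append[OF Q(3)] trail_append[OF trail_rev[OF tr(1)]]
          trail_append[OF trail_rev[OF s3(4), folded z]] trail_append[OF trf'] s2(4))
    moreover have "distinct (Q @ rev P1 @ rev P3b @ [f] @ P2b)"
      using Q(4) dQ dist s3(1) s2(1) fP by auto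
    moreover have "R \<subseteq> ({a3, a2} \<union> U) \<union> (W1 \<union> (W3b \<union> ({r23, z} \<union> W2b)))"
      using R KU z e r12 by auto
    ultimately show False using R_not_all_visited[OF KW] by blast
  next
    assume z: "z = a1"
    have trf': "trail a1 [f] r23 {r23, z}" using trail_rev[OF trf] z by simp
    \<comment> \<open>This route passes \<open>a1\<close> midway: through \<open>K\<close> to
      \<open>a2\<close>, back through \<open>r12\<close> to \<open>a1\<close>, over \<open>f\<close>
      to \<open>r23\<close>, on to \<open>a3\<close>, and through \<open>r31\<close> to
      \<open>a1\<close>.\<close>
    have "trail a1 (Q' @ rev P1 @ [f] @ P2b @ P3) a1 (({a1, a2} \<union> U') \<union> (W1 \<union> ({r23, z} \<union> (W2b \<union> W3))))"
      by (intro trail_append[OF Q'(3)] trail_append[OF trail_rev[OF tr(1)]]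
          trail_append[OF trf'] trail_append[OF s2(4)] tr(3))
    moreover have "distinct (Q' @ rev P1 @ [f] @ P2b @ P3)"
      using Q'(4) dQ' dist s2(1) fP by auto
    moreover have "R \<subseteq> ({a1, a2} \<union> U') \<union> (W1 \<union> ({r23, z} \<union> (W2b \<union> W3)))"
      using R Q'(6) e r12 r31 by auto
    ultimately show False using R_not_all_visited[OF KW] by blast
  qed
qed

text \<open>If a missed edge lies in a node of \<open>R\<close>, connectedness of \<open>R\<close>
  gives an edge \<open>b1\<close> between a node \<open>K\<close> of its component and a visited
  node \<open>a1\<close>, both in \<open>R\<close>, and \<open>missing_node\<close> applies. If no
  missed edge does, \<open>v\<close> is the missed edge.\<close>

lemma all_covered:
  assumes "e \<in> V"
  shows "\<exists>N\<in>W. e \<in> N"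
proof (rule ccontr)
  assume "\<not> (\<exists>N\<in>W. e \<in> N)"
  then have e_unc: "\<And>N. N \<in> W \<Longrightarrow> e \<notin> N" by blast
  show False
  proof (cases "\<exists>e r. e \<in> V \<and> (\<forall>N\<in>W. e \<notin> N) \<and> r \<in> R \<and> e \<in> r")
    case False
    have "e = v" using False R_covers assms e_unc by blast
    show False
    proof (rule only_v_uncovered)
      show "\<And>e r. \<lbrakk>e \<in> V; \<And>N. N \<in> W \<Longrightarrow> e \<notin> N; r \<in> R\<rbrakk> \<Longrightarrow> e \<notin> r" using False by blast
      show "\<And>N. N \<in> W \<Longrightarrow> v \<notin> N" using e_unc \<open>e = v\<close> by blast
    qed
  next
    case True
    then obtain g K0 where g: "g \<in> V" "\<And>N. N \<in> W \<Longrightarrow> g \<notin> N" "K0 \<in> R" "g \<in> K0" by blast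
    have K0: "K0 \<in> \<N> - W" using g R_nodes by blast
    have "R \<inter> component K0 \<noteq> {}" using g self_in_component by blast
    moreover have "R \<inter> component K0 \<noteq> R"
      using ex_R_visited component_subset[OF K0] by blast
    ultimately obtain K a1 b1 where K: "K \<in> R" "K \<in> component K0" and a1: "a1 \<in> R" "a1 \<notin> component K0"
      and b1: "b1 \<in> K" "b1 \<in> a1"
      using R_connected[of "R \<inter> component K0"] by blast
    have comp: "component K = component K0" using component_sym[OF K(2)] .
    have KW: "K \<in> \<N> - W" using component_subset[OF K0] K by blast
    have "a1 \<in> W" using component_step[OF K(2) K0 _ b1] a1 R_nodes by blast
    then have att1: "attached K b1 K a1" using b1 self_in_component by (simp add: attached_def)
    have "N \<in> component K" if "N \<in> \<N>" "g \<in> N" for N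
      using component_step[OF self_in_component K0 that(1) g(4) that(2)] g(2) that comp by blast
    then have "3 \<le> card {b. \<exists>h a. attached K b h a}"
      using three_attachments[OF KW g(1)] by blast
    then obtain T where T: "T \<subseteq> {b. \<exists>h a. attached K b h a}" "card T = 3"
      using obtain_subset_with_card_n by metis
    have "\<exists>b2 b3. b2 \<in> T \<and> b3 \<in> T \<and> b1 \<noteq> b2 \<and> b1 \<noteq> b3 \<and> b2 \<noteq> b3"
      using T(2) by (auto simp: card_3_iff)
    then obtain b2 b3 where b: "b2 \<in> T" "b3 \<in> T" "b1 \<noteq> b2" "b1 \<noteq> b3" "b2 \<noteq> b3" by blast
    obtain h2 a2 where att2: "attached K b2 h2 a2" using T(1) b(1) by blast
    obtain h3 a3 where att3: "attached K b3 h3 a3" using T(1) b(2) by blast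
    have W: "a1 \<in> W" "a2 \<in> W" "a3 \<in> W" using att1 att2 att3 by (auto simp: attached_def)
    from ex_pieces[OF W] show False
      using missing_node[OF KW K(1) a1(1) att1 att2 att3 b(3-5)]
        missing_node[OF KW K(1) a1(1) att1 att3 att2 b(4,3) b(5)[symmetric]]
      by (elim disjE exE)
  qed
qed

end

theorem (in covered_line_structure) hamiltonian:
  assumes "3 \<le> card V"
  shows "\<exists>c. hamiltonian_cycle adj V c"
proof -
  obtain A p W where W: "admissible A p W" "\<forall>A' p' W'. admissible A' p' W' \<longrightarrow> score W' \<le> score W"
    using ex_optimal by blast
  interpret optimal_trail V \<N> R v A p W
    using W by unfold_locales blast+
  have "set p \<subseteq> V"
    using trail_edge_in_node[OF closed(1)] W_nodes edge_in_V by blast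
  then show ?thesis
    using closed_trail_hamiltonian[OF closed _ all_covered assms] by blast
qed

section \<open>Claw-free graphs without diamonds\<close>

locale line_graph =
  fixes V :: "'a set" and E :: "'a \<Rightarrow> 'a \<Rightarrow> bool"
  assumes finite_V: "finite V" and sym: "symp E" and irr: "irreflp E" and in_V: "E a b \<Longrightarrow> a \<in> V"
    and claw_free: "claw_free_rel E" and diamond_free: "diamond_free_rel E"
begin

text \<open>For adjacent \<open>x, y\<close> this is the unique maximal clique containing both.\<close>

definition clique :: "'a \<Rightarrow> 'a \<Rightarrow> 'a set" where
  "clique x y = {u \<in> V. (u = x \<or> E u x) \<and> (u = y \<or> E u y)}"

definition nodes :: "'a set set" where
  "nodes = {clique x y | x y. E x y}"

lemma E_sym: "E a b \<Longrightarrow> E b a"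
  using sym by (auto simp: symp_def)

lemma E_irr: "\<not> E a a"
  using irr by (auto simp: irreflp_def)

lemma diamond: "\<lbrakk>E x w; E x y; E x z; E w y; E w z; y \<noteq> z\<rbrakk> \<Longrightarrow> E y z"
  using diamond_free unfolding diamond_free_rel_def by blast

lemma node_adjacent:
  assumes "N \<in> nodes" "u \<in> N" "w \<in> N" "u \<noteq> w"
  shows "E u w"
proof -
  obtain x y where xy: "E x y" "N = clique x y" using assms(1) by (auto simp: nodes_def)
  then show ?thesis
    using assms diamond[of x y u w] E_sym unfolding clique_def by blast
qed

text \<open>Without diamonds, a vertex adjacent to both \<open>a\<close> and \<open>b\<close> is
  adjacent to every further element of \<open>N\<close>.\<close>

lemma node_eq_clique:
  assumes N: "N \<in> nodes" "a \<in> N" "b \<in> N" "a \<noteq> b"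
  shows "N = clique a b"
proof
  have ab: "E a b" using node_adjacent[OF N] .
  have "N \<subseteq> V" using N(1) by (auto simp: nodes_def clique_def)
  then show "N \<subseteq> clique a b"
    using node_adjacent[OF N(1)] N by (auto simp: clique_def)
  obtain x y where xy: "E x y" "N = clique x y" using N(1) by (auto simp: nodes_def)
  have "x \<in> N" "y \<in> N" using xy in_V E_sym by (auto simp: clique_def)
  have *: "u = c \<or> E u c" if "c \<in> N" "u \<in> clique a b" for u c
  proof -
    have c: "c = a \<or> E a c" "c = b \<or> E b c" using node_adjacent[OF N(1)] that N by blast+
    have u: "u = a \<or> E a u" "u = b \<or> E b u" using that E_sym by (auto simp: clique_def)
    show ?thesis using c u ab diamond[of a b u c] E_sym by blast
  qed
  show "clique a b \<subseteq> N"
    using *[OF \<open>x \<in> N\<close>] *[OF \<open>y \<in> N\<close>] xy(2) by (auto simp: clique_def)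
qed

lemma clique_node: "E x y \<Longrightarrow> clique x y \<in> nodes \<and> x \<in> clique x y \<and> y \<in> clique x y"
  using in_V E_sym by (auto simp: nodes_def clique_def)

lemma node_other:
  assumes "N \<in> nodes" shows "\<exists>a\<in>N. a \<noteq> e"
proof -
  obtain x y where "E x y" "N = clique x y" using assms by (auto simp: nodes_def)
  then show ?thesis using clique_node[of x y] E_irr by (metis)
qed

text \<open>Two elements determine a node, which gives linearity. If \<open>e\<close> lay in three
  nodes, neighbours of \<open>e\<close> chosen from each would form a claw.\<close>

sublocale line_structure V nodes
proof
  show lin: "e = f" if h: "A \<in> nodes" "B \<in> nodes" "A \<noteq> B" "e \<in> A" "e \<in> B" "f \<in> A" "f \<in> B" for A B e f
    using node_eq_clique[of A e f] node_eq_clique[of B e f] h by blast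
  show "A = B \<or> A = C \<or> B = C"
    if h: "A \<in> nodes" "B \<in> nodes" "C \<in> nodes" "e \<in> A" "e \<in> B" "e \<in> C" for A B C e
  proof (rule ccontr)
    assume ne: "\<not> (A = B \<or> A = C \<or> B = C)"
    obtain a b c where abc: "a \<in> A" "a \<noteq> e" "b \<in> B" "b \<noteq> e" "c \<in> C" "c \<noteq> e"
      using node_other h by meson
    have no: False if "X \<in> nodes" "Y \<in> nodes" "X \<noteq> Y" "e \<in> X" "e \<in> Y" "x \<in> X" "x \<noteq> e" "y \<in> Y" "y \<noteq> e"
      "E x y" for X Y x y
    proof -
      have "E e x" "E e y" using node_adjacent[of X e x] node_adjacent[of Y e y] that by auto
      then have "y \<in> clique e x"
        using \<open>E x y\<close> in_V E_sym by (auto simp: clique_def)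
      then have "y \<in> X" using node_eq_clique[of X e x] that by auto
      then show False using lin[of X Y e y] that by auto
    qed
    have "E e a" "E e b" "E e c" using node_adjacent h abc by auto
    moreover have "a \<noteq> b" "a \<noteq> c" "b \<noteq> c" using lin h abc ne by metis+
    ultimately have "E a b \<or> E a c \<or> E b c" using claw_free_relD[OF claw_free] by blast
    then show False
      using no[of A B a b] no[of A C a c] no[of B C b c] h abc ne by blast
  qed
qed (use finite_V in \<open>auto simp: nodes_def clique_def\<close>)

lemma adj_eq: "adj = E"
proof (intro ext iffI)
  show "E x y" if "adj x y" for x y using that node_adjacent by (auto simp: adj_def)
  show "adj x y" if "E x y" for x y using that clique_node E_irr by (auto simp: adj_def)
qed

section \<open>The nodes meeting a connected set of vertices\<close>

definition nodes_of :: "'a set \<Rightarrow> 'a set set" where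
  "nodes_of D = {N \<in> nodes. N \<inter> D \<noteq> {}}"

lemma finite_nodes_of: "finite (nodes_of D)"
  using finite_nodes by (simp add: nodes_of_def)

lemma card_nodes_of_single: "card (nodes_of {d}) \<le> 2"
proof (rule ccontr)
  assume "\<not> card (nodes_of {d}) \<le> 2"
  then have "3 \<le> card (nodes_of {d})" by simp
  then obtain T where "T \<subseteq> nodes_of {d}" "card T = 3"
    using obtain_subset_with_card_n by metis
  then obtain A B C where "T = {A, B, C}" "A \<noteq> B" "A \<noteq> C" "B \<noteq> C"
    by (auto simp: card_3_iff)
  then show False
    using \<open>T \<subseteq> nodes_of {d}\<close> two_nodes[of A B C d] by (auto simp: nodes_of_def)
qed

text \<open>The vertex \<open>d\<close> lies in at most two nodes, and the one it shares with
  \<open>d'\<close> is already counted.\<close>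

lemma nodes_of_insert:
  assumes "E d' d" "d' \<in> D"
  shows "card (nodes_of (insert d D)) \<le> Suc (card (nodes_of D))"
proof -
  let ?N = "clique d' d"
  have N: "?N \<in> nodes_of {d}" "?N \<in> nodes_of D"
    using clique_node[OF assms(1)] assms(2) by (auto simp: nodes_of_def)
  have "card (nodes_of {d} - {?N}) \<le> 1"
    using card_nodes_of_single[of d] N(1) by (simp add: finite_nodes_of)
  moreover have "nodes_of (insert d D) \<subseteq> nodes_of D \<union> (nodes_of {d} - {?N})"
    using N(2) by (auto simp: nodes_of_def)
  then have "card (nodes_of (insert d D)) \<le> card (nodes_of D \<union> (nodes_of {d} - {?N}))"
    by (intro card_mono) (simp_all add: finite_nodes_of)
  ultimately show ?thesis
    using card_Un_le[of "nodes_of D" "nodes_of {d} - {?N}"] by linarith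
qed

lemma card_nodes_of:
  assumes D: "finite D" "D \<noteq> {}" "cut_connected E D"
  shows "card (nodes_of D) \<le> Suc (card D)"
proof -
  have "\<exists>D'\<subseteq>D. card D' = n \<and> card (nodes_of D') \<le> Suc n" if "1 \<le> n" "n \<le> card D" for n
    using that
  proof (induction n rule: nat_induct_at_least)
    case base
    obtain d where "d \<in> D" using D by blast
    then show ?case using card_nodes_of_single[of d] by (intro exI[of _ "{d}"]) auto
  next
    case (Suc n)
    then obtain D' where D': "D' \<subseteq> D" "card D' = n" "card (nodes_of D') \<le> Suc n" by auto
    have "D' \<noteq> {}" "D' \<noteq> D" using D' Suc by auto
    then obtain d' d where d: "d' \<in> D'" "d \<in> D - D'" "E d' d"
      using D(3) D'(1) unfolding cut_connected_def by meson
    have fin: "finite D'" using D' D finite_subset by auto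
    show ?case
      using nodes_of_insert[OF d(3,1)] d D' fin by (intro exI[of _ "insert d D'"]) auto
  qed
  from this[of "card D"] obtain D' where D': "D' \<subseteq> D" "card D' = card D" "card (nodes_of D') \<le> Suc (card D)"
    using D by (auto simp: Suc_le_eq card_gt_0_iff)
  then show ?thesis using card_subset_eq[OF D(1) D'(1,2)] by simp
qed

text \<open>If the nodes in \<open>T\<close> cover \<open>D\<close>, any other node shares a vertex
  of \<open>D\<close> with one of them. If not, an edge of \<open>D\<close> leaving the covered part
  spans a clique that is not in \<open>T\<close> but meets a member of \<open>T\<close>.\<close>

lemma nodes_of_connected:
  assumes D: "cut_connected E D" and T: "T \<subseteq> nodes_of D" "T \<noteq> {}" "T \<noteq> nodes_of D"
  shows "\<exists>r\<in>T. \<exists>z\<in>nodes_of D - T. r \<inter> z \<noteq> {}"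
proof -
  define D' where "D' = {d \<in> D. \<exists>N\<in>T. d \<in> N}"
  obtain Z where Z: "Z \<in> nodes_of D - T" using T by blast
  show ?thesis
  proof (cases "D' = D")
    case True
    obtain d where "d \<in> Z" "d \<in> D" using Z by (auto simp: nodes_of_def)
    then obtain N where "N \<in> T" "d \<in> N" using True by (auto simp: D'_def)
    then show ?thesis using Z \<open>d \<in> Z\<close> by blast
  next
    case False
    obtain N where "N \<in> T" using T by blast
    then have "D' \<noteq> {}" "D' \<subseteq> D" using T(1) by (auto simp: D'_def nodes_of_def)
    then obtain d d' where d: "d \<in> D'" "d' \<in> D - D'" "E d d'"
      using D False unfolding cut_connected_def by meson
    obtain M where M: "M \<in> T" "d \<in> M" using d(1) by (auto simp: D'_def)
    note c = clique_node[OF d(3)]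
    have "clique d d' \<in> nodes_of D - T"
      using c d(2) by (auto simp: D'_def nodes_of_def)
    then show ?thesis using M c by blast
  qed
qed

theorem hamiltonian_if_dominated:
  assumes conn: "\<And>X. \<lbrakk>X \<subseteq> V; card X < 3\<rbrakk> \<Longrightarrow> cut_connected E (V - X)" and card_V: "4 \<le> card V"
    and v: "v \<in> V" and D: "D \<subseteq> V" "D \<noteq> {}" "card D \<le> 4" "cut_connected E D"
    and dom: "\<And>w. w \<in> V - D - {v} \<Longrightarrow> \<exists>u\<in>D. E u w"
  shows "\<exists>c. hamiltonian_cycle E V c"
proof -
  \<comment> \<open>Deleting fewer than three neighbours of \<open>d\<close> would isolate it from a
    remaining vertex.\<close>
  have deg: "3 \<le> card {u. E d u}" if "d \<in> V" for d
  proof (rule ccontr)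
    assume "\<not> 3 \<le> card {u. E d u}"
    then have c: "card {u. E d u} < 3" by simp
    have sub: "{u. E d u} \<subseteq> V" using in_V E_sym by blast
    have "d \<in> V - {u. E d u}" using that E_irr by blast
    moreover have "card {u. E d u} + card (V - {u. E d u}) = card V"
      using sub finite_V by (metis card_Diff_subset card_mono finite_subset le_add_diff_inverse)
    then have "V - {u. E d u} \<noteq> {d}" using c card_V by auto
    ultimately have "\<exists>a\<in>{d}. \<exists>b\<in>V - {u. E d u} - {d}. E a b"
      using conn[OF sub c] unfolding cut_connected_def by blast
    then show False by blast
  qed
  have nbr: "\<exists>u. E d u" if "d \<in> V" for d
    using deg[OF that] by (metis Collect_empty_eq card.empty not_numeral_le_zero)
  interpret covered_line_structure V nodes "nodes_of D" v
  proof
    show "\<exists>N\<in>nodes. e \<in> N" if "e \<in> V" for e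
      using nbr[OF that] clique_node by blast
    show "cut_connected adj (V - X)" if "X \<subseteq> V" "card X < 3" for X
      using conn[OF that] by (simp add: adj_eq)
    show "nodes_of D \<subseteq> nodes" by (auto simp: nodes_of_def)
    have "finite D" using D(1) finite_V by (rule finite_subset)
    then show "card (nodes_of D) \<le> 5" using card_nodes_of[of D] D by simp
    show "\<exists>r\<in>T. \<exists>z\<in>nodes_of D - T. r \<inter> z \<noteq> {}"
      if "T \<subseteq> nodes_of D" "T \<noteq> {}" "T \<noteq> nodes_of D" for T
      using nodes_of_connected[OF D(4) that] .
    show "\<exists>r\<in>nodes_of D. e \<in> r" if e: "e \<in> V" "e \<noteq> v" for e
    proof (cases "e \<in> D")
      case True
      obtain u where "E e u" using nbr[OF e(1)] by blast
      then show ?thesis using clique_node[of e u] True by (auto simp: nodes_of_def)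
    next
      case False
      then obtain u where "u \<in> D" "E u e" using dom[of e] e by blast
      then show ?thesis using clique_node[of u e] by (auto simp: nodes_of_def)
    qed
    \<comment> \<open>The at least three neighbours of a vertex of \<open>D\<close> are spread over
      at most two nodes, each of which also contains that vertex.\<close>
    show "\<exists>r\<in>nodes_of D. 3 \<le> card r"
    proof (rule ccontr)
      assume small: "\<not> (\<exists>r\<in>nodes_of D. 3 \<le> card r)"
      obtain d where d: "d \<in> D" using D by blast
      have sub: "nodes_of {d} \<subseteq> nodes_of D" using d by (auto simp: nodes_of_def)
      have "{u. E d u} \<subseteq> (\<Union>N\<in>nodes_of {d}. N - {d})"
        using clique_node E_irr by (fastforce simp: nodes_of_def)
      moreover have "finite (\<Union>N\<in>nodes_of {d}. N - {d})"
      proof (rule finite_subset[OF _ finite_V])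
        show "(\<Union>N\<in>nodes_of {d}. N - {d}) \<subseteq> V"
          using node_subset by (auto simp: nodes_of_def)
      qed
      ultimately have "card {u. E d u} \<le> card (\<Union>N\<in>nodes_of {d}. N - {d})"
        by (rule card_mono[rotated])
      also have "\<dots> \<le> (\<Sum>N\<in>nodes_of {d}. card (N - {d}))"
        by (rule card_UN_le[OF finite_nodes_of])
      also have "\<dots> \<le> (\<Sum>N\<in>nodes_of {d}. 1)"
      proof (rule sum_mono)
        fix N assume N: "N \<in> nodes_of {d}"
        then have "card N \<le> 2" "d \<in> N" using small sub by (auto simp: nodes_of_def not_le)
        then show "card (N - {d}) \<le> 1" by (simp add: card_Diff_singleton_if)
      qed
      also have "\<dots> \<le> 2" using card_nodes_of_single[of d] by simp
      finally show False using deg[of d] d D(1) by auto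
    qed
    show "v \<in> V" by (rule v)
  qed
  show ?thesis using hamiltonian card_V by (simp add: adj_eq)
qed

end

lemma cut_connected_mono:
  "\<lbrakk>cut_connected E X; \<And>a b. E a b \<Longrightarrow> E' a b\<rbrakk> \<Longrightarrow> cut_connected E' X"
  unfolding cut_connected_def by blast

text \<open>Induction on the number of nonadjacent pairs: completing at the hub of a diamond keeps
  all hypotheses and joins \<open>y\<close> to \<open>z\<close>, and
  \<open>hamiltonian_local_completion\<close> pulls the cycle back.\<close>

theorem claw_free_hamiltonian:
  assumes fin: "finite V" and "symp E" "irreflp E" and "\<And>a b. E a b \<Longrightarrow> a \<in> V" "claw_free_rel E"
    and "\<And>X. \<lbrakk>X \<subseteq> V; card X < 3\<rbrakk> \<Longrightarrow> cut_connected E (V - X)" and card_V: "4 \<le> card V"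
    and v: "v \<in> V" and D: "D \<subseteq> V" "D \<noteq> {}" "card D \<le> 4" and "cut_connected E D"
    and "\<And>w. w \<in> V - D - {v} \<Longrightarrow> \<exists>u\<in>D. E u w"
  shows "\<exists>c. hamiltonian_cycle E V c"
  using assms(2-6,12-)
proof (induction "card {(a, b) \<in> V \<times> V. \<not> E a b}" arbitrary: E rule: less_induct)
  case less
  show ?case
  proof (cases "diamond_free_rel E")
    case True
    interpret line_graph V E
      using fin less.prems True by unfold_locales
    show ?thesis
      using hamiltonian_if_dominated[OF less.prems(5) card_V v D less.prems(6,7)] .
  next
    case False
    then obtain x w y z where d: "E x w" "E x y" "E x z" "E w y" "E w z" "y \<noteq> z" "\<not> E y z"
      by (auto simp: diamond_free_rel_def)
    let ?E = "local_completion E x"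
    have E_sym: "E a b \<Longrightarrow> E b a" for a b using less.prems(1) by (auto simp: symp_def)
    have mono: "?E a b" if "E a b" for a b using that by (simp add: local_completion_def)
    have inV: "?E a b \<Longrightarrow> a \<in> V" for a b
      using less.prems(3) E_sym by (auto simp: local_completion_def)
    have less: "card {(a, b) \<in> V \<times> V. \<not> ?E a b} < card {(a, b) \<in> V \<times> V. \<not> E a b}"
    proof (rule psubset_card_mono)
      show "finite {(a, b) \<in> V \<times> V. \<not> E a b}"
        by (rule finite_subset[of _ "V \<times> V"]) (use fin in auto)
      have "(y, z) \<in> {(a, b) \<in> V \<times> V. \<not> E a b}"
        using d less.prems(3) E_sym by auto
      moreover have "(y, z) \<notin> {(a, b) \<in> V \<times> V. \<not> ?E a b}"
        using d by (auto simp: local_completion_def)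
      ultimately show "{(a, b) \<in> V \<times> V. \<not> ?E a b} \<subset> {(a, b) \<in> V \<times> V. \<not> E a b}"
        using mono by blast
    qed
    have sym: "symp ?E" using E_sym by (auto simp: symp_def local_completion_def)
    have irr: "irreflp ?E" using less.prems(2) by (auto simp: irreflp_def local_completion_def)
    have cf: "claw_free_rel ?E"
      by (rule claw_free_local_completion[OF less.prems(1,2,4)])
    have conn: "cut_connected ?E (V - X)" if "X \<subseteq> V" "card X < 3" for X
      using less.prems(5)[OF that] mono by (rule cut_connected_mono)
    have conn_D: "cut_connected ?E D"
      using less.prems(6) mono by (rule cut_connected_mono)
    have dom: "\<exists>u\<in>D. ?E u w" if "w \<in> V - D - {v}" for w
      using less.prems(7)[OF that] mono by blast
    have "\<exists>c. hamiltonian_cycle ?E V c"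
      by (rule less.hyps[OF less sym irr _ cf _ conn_D]) (fact inV conn dom)+
    then obtain c where c: "hamiltonian_cycle ?E V c" by blast
    show ?thesis
      by (rule hamiltonian_local_completion[OF fin less.prems(1,2) _ less.prems(4) d c])
        (fact less.prems(3))
  qed
qed

section \<open>Digraph formulation\<close>

text \<open>A set without leaving edges is closed under reachability in the symmetric
  closure.\<close>

lemma cut_connected_verts:
  assumes conn: "Digraph_Component.connected H" and sym: "symp E"
    and arcs: "\<And>e. e \<in> arcs H \<Longrightarrow> E (tail H e) (head H e)"
  shows "cut_connected E (verts H)"
  unfolding cut_connected_def
proof (intro allI impI, rule ccontr)
  fix A assume A: "A \<subseteq> verts H" "A \<noteq> {}" "A \<noteq> verts H" and no: "\<not> (\<exists>a\<in>A. \<exists>b\<in>verts H - A. E a b)"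
  obtain a b where ab: "a \<in> A" "b \<in> verts H - A" using A by blast
  have verts: "verts (with_proj (mk_symmetric H)) = verts H"
    by (simp add: mk_symmetric_def)
  have "a \<rightarrow>\<^sup>*\<^bsub>with_proj (mk_symmetric H)\<^esub> b"
    using conn ab A verts unfolding connected_def strongly_connected_def by auto
  then have "(a, b) \<in> rtrancl_on (verts H) (parcs (mk_symmetric H))"
    by (simp add: reachable_def mk_symmetric_def)
  then have "b \<in> A"
  proof (induction rule: rtrancl_on_induct)
    case base
    show ?case by (rule ab(1))
  next
    case (step y z)
    obtain e where e: "e \<in> arcs H" "(y, z) = (tail H e, head H e) \<or> (y, z) = (head H e, tail H e)"
      using step by (auto simp: mk_symmetric_def)
    then have "E y z" using arcs[OF e(1)] sym by (auto simp: symp_def)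
    then show ?case using step no by blast
  qed
  then show False using ab by blast
qed

lemma claw_free_relI:
  assumes "graph G" "Defs.claw_free G"
  shows "claw_free_rel (\<lambda>x y. x \<rightarrow>\<^bsub>G\<^esub> y)"
  unfolding claw_free_rel_def
proof (intro allI impI, rule ccontr)
  interpret graph G by (rule assms(1))
  fix x a b c
  assume adj: "x \<rightarrow>\<^bsub>G\<^esub> a" "x \<rightarrow>\<^bsub>G\<^esub> b" "x \<rightarrow>\<^bsub>G\<^esub> c" and ne: "a \<noteq> b" "a \<noteq> c" "b \<noteq> c"
    and "\<not> (a \<rightarrow>\<^bsub>G\<^esub> b \<or> a \<rightarrow>\<^bsub>G\<^esub> c \<or> b \<rightarrow>\<^bsub>G\<^esub> c)"
  then have no: "\<not> a \<rightarrow>\<^bsub>G\<^esub> b" "\<not> a \<rightarrow>\<^bsub>G\<^esub> c" "\<not> b \<rightarrow>\<^bsub>G\<^esub> c" by auto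
  have sym: "p \<rightarrow>\<^bsub>G\<^esub> q \<Longrightarrow> q \<rightarrow>\<^bsub>G\<^esub> p" for p q
    using sym_arcs by (auto simp: symmetric_def sym_def)
  have irr: "\<not> p \<rightarrow>\<^bsub>G\<^esub> p" for p using no_loops by (auto simp: arcs_ends_conv)
  let ?X = "{x, a, b, c}"
  let ?H = "G \<restriction> ?X"
  have X: "?X \<subseteq> verts G" using adj by (auto simp: arcs_ends_conv)
  have ends: "arcs_ends ?H = {(p, q). p \<in> ?X \<and> q \<in> ?X \<and> p \<rightarrow>\<^bsub>G\<^esub> q}"
    by (auto simp: arcs_ends_conv induce_subgraph_def)
  have ind: "induced_subgraph ?H G" using X by (rule induced_induce)
  have sup: "p \<noteq> q" if "p \<rightarrow>\<^bsub>G\<^esub> q" for p q using irr that by auto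
  have "graph ?H"
  proof -
    interpret H: digraph ?H by (rule digraphI_induced[OF ind])
    show ?thesis using sym by (intro H.graphI) (auto simp: symmetric_def sym_def ends)
  qed
  moreover have "verts ?H = {x} \<union> {a, b, c}" by auto
  moreover have "{x} \<inter> {a, b, c} = {}" using sup adj by auto
  moreover have "card {x} = 1" "card {a, b, c} = 3" using ne by auto
  moreover have "arcs_ends ?H = {x} \<times> {a, b, c} \<union> {a, b, c} \<times> {x}"
    unfolding ends using adj no sym irr by auto
  ultimately have "K\<^bsub>1,3\<^esub> ?H"
    unfolding complete_bipartite_digraph_def by blast
  then show False using assms(2) ind unfolding claw_free_def by blast
qed

lemma (in wf_digraph) awalk_of_vertices:
  assumes "successively (\<lambda>x y. x \<rightarrow>\<^bsub>G\<^esub> y) (x # xs @ [y])"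
  shows "\<exists>p. set p \<subseteq> arcs G \<and> cas x p y \<and> awalk_verts x p = x # xs @ [y] \<and> map (tail G) p = x # xs"
  using assms
proof (induction xs arbitrary: x)
  case Nil
  then obtain e where "e \<in> arcs G" "tail G e = x" "head G e = y" by (auto simp: arcs_ends_conv)
  then show ?case by (intro exI[of _ "[e]"]) auto
next
  case (Cons z xs)
  have "successively (\<lambda>x y. x \<rightarrow>\<^bsub>G\<^esub> y) (z # xs @ [y])" "x \<rightarrow>\<^bsub>G\<^esub> z"
    using Cons.prems by auto
  from Cons.IH[OF this(1)] obtain p where p: "set p \<subseteq> arcs G" "cas z p y"
    "awalk_verts z p = z # xs @ [y]" "map (tail G) p = z # xs" by (elim exE conjE)
  obtain e where "e \<in> arcs G" "tail G e = x" "head G e = z"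
    using \<open>x \<rightarrow>\<^bsub>G\<^esub> z\<close> by (auto simp: arcs_ends_conv)
  then show ?case using p by (intro exI[of _ "e # p"]) auto
qed

lemma hamiltonianI:
  assumes "graph G" "hamiltonian_cycle (\<lambda>x y. x \<rightarrow>\<^bsub>G\<^esub> y) (verts G) c"
  shows "Defs.hamiltonian G"
proof -
  interpret graph G by (rule assms(1))
  have c: "distinct c" "set c = verts G" "3 \<le> length c" "successively (\<lambda>x y. x \<rightarrow>\<^bsub>G\<^esub> y) c" "last c \<rightarrow>\<^bsub>G\<^esub> hd c"
    using assms(2) by (auto simp: hamiltonian_cycle_def)
  obtain x xs where x: "c = x # xs" using c(3) by (cases c) auto
  have "successively (\<lambda>x y. x \<rightarrow>\<^bsub>G\<^esub> y) ((x # xs) @ [x])"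
    using c(4,5) x by (simp add: successively_append_iff del: append_Cons)
  then have "successively (\<lambda>x y. x \<rightarrow>\<^bsub>G\<^esub> y) (x # xs @ [x])" by simp
  from awalk_of_vertices[OF this] obtain p where p: "set p \<subseteq> arcs G" "cas x p x"
    "awalk_verts x p = x # xs @ [x]" "map (tail G) p = x # xs" by (elim exE conjE)
  have "length p = length c" using arg_cong[OF p(4), of length] x by simp
  moreover have "tail G ` set p = verts G" using arg_cong[OF p(4), of set] x c(2) by simp
  moreover have "cycle p"
    unfolding cycle_def awalk_def using p c x \<open>length p = length c\<close> by (intro exI[of _ x]) auto
  ultimately show ?thesis using c(3) unfolding Defs.hamiltonian_def by auto
qed

theorem theorem3p8:
  fixes G :: "('a,'b) pre_digraph" and k :: nat
  assumes "k \<in> {4, 5}"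
    and "graph G"
    and "k_connected 3 G"
    and "gamma_c_vertex_critical k G"
    and "claw_free G"
  shows "hamiltonian G"
proof -
  interpret graph G by (rule assms(2))
  let ?E = "\<lambda>x y. x \<rightarrow>\<^bsub>G\<^esub> y"
  have sym: "symp ?E" using sym_arcs by (auto simp: symmetric_def sym_def symp_def)
  have card_V: "4 \<le> card (verts G)" using assms(3) by (simp add: k_connected_def)
  then obtain v where v: "v \<in> verts G" by (cases "verts G = {}") auto
  have "gamma_c (del_vert v) < enat k" using assms(4) v by (auto simp: gamma_c_vertex_critical_def)
  \<comment> \<open>An infimum below \<open>k\<close> is witnessed by a set of fewer than
    \<open>k\<close>, hence at most four, vertices.\<close>
  then obtain D where D: "connected_dominating_set (del_vert v) D" "card D < k"
    unfolding gamma_c_def by (auto simp: Inf_less_iff)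
  have D_sub: "D \<subseteq> verts G" using D(1) by (auto simp: connected_dominating_set_def del_vert_simps)
  have D_conn: "Digraph_Component.connected (del_vert v \<restriction> D)"
    using D(1) by (simp add: connected_dominating_set_def)
  have "\<exists>c. hamiltonian_cycle ?E (verts G) c"
  proof (rule claw_free_hamiltonian[OF _ sym _ _ _ _ card_V v D_sub])
    show "irreflp ?E" using no_loops by (auto simp: irreflp_def arcs_ends_conv)
    show "a \<in> verts G" if "a \<rightarrow>\<^bsub>G\<^esub> b" for a b using that by (auto simp: arcs_ends_conv)
    show "claw_free_rel ?E" by (rule claw_free_relI[OF assms(2,5)])
    show "cut_connected ?E (verts G - X)" if "X \<subseteq> verts G" "card X < 3" for X
    proof -
      have "Digraph_Component.connected (G \<restriction> (verts G - X))"
        using assms(3) that by (simp add: k_connected_def)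
      from cut_connected_verts[OF this sym] show ?thesis
        by (auto simp: arcs_ends_conv induce_subgraph_def)
    qed
    \<comment> \<open>Connectedness includes having at least one vertex.\<close>
    show "D \<noteq> {}"
      using D_conn by (auto simp: connected_def strongly_connected_def mk_symmetric_def)
    show "card D \<le> 4" using D(2) assms(1) by auto
    from cut_connected_verts[OF D_conn sym] show "cut_connected ?E D"
      by (auto simp: arcs_ends_conv induce_subgraph_def del_vert_simps)
    show "\<exists>u\<in>D. u \<rightarrow>\<^bsub>G\<^esub> w" if "w \<in> verts G - D - {v}" for w
    proof -
      have "w \<in> verts (del_vert v) - D" using that by (simp add: del_vert_simps)
      then obtain u where "u \<in> D" "u \<rightarrow>\<^bsub>del_vert v\<^esub> w"
        using D(1) by (auto simp: connected_dominating_set_def)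
      then show ?thesis by (auto simp: arcs_ends_conv del_vert_simps)
    qed
  qed simp
  then show ?thesis using hamiltonianI[OF assms(2)] by blast
qed

end
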